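(* Let $n\ge1$ and let $w,w'\in A_n^\dagger$ be timed words. Then $w\equiv w'$ (that is, $w$ and $w'$ are Knuth equivalent) if and only if, for all $u,v\in A_n^\dagger$, $$a_r(uwv)=a_r(uw'v)\quad\text{for all integers } r>0.$$
   Context: **Timed words.** Let $A_n=\{1,\dots,n\}$ with its usual order. A timed word in $A_n$ is a finite (possibly empty) sequence $w=c_1^{t_1}c_2^{t_2}\cdots c_k^{t_k}$ with $c_i\in A_n$, $t_i$ positive real numbers, and $c_i\ne c_{i+1}$ for $1\le i\le k-1$. A sequence in which $c_i=c_{i+1}$ for some $i$ also represents a timed word: segments $c^{t}c^{t'}$ are replaced by $c^{t+t'}$ until consecutive letters differ. The length of $w$ is $l(w)=t_1+\dots+t_k$. The function associated to $w$ is the piecewise constant function $\mathbf w:[0,l(w))\to A_n$ given by $\mathbf w(t)=c_i$ if $t_1+\dots+t_{i-1}\le t<t_1+\dots+t_i$; it determines $w$. The set of timed words in $A_n$ is a monoid under concatenation, denoted $A_n^\dagger$. A timed word $c_1^{t_1}\cdots c_k^{t_k}$ (with consecutive letters distinct) is a timed row if $c_1<\dots<c_k$. **Subwords.** A time sample of $w$ is a subset of $[0,l(w))$ of the form $S=[a_1,b_1)\cup\dots\cup[a_k,b_k)$ with $0\le a_1<b_1<a_2<b_2<\dots<a_k<b_k\le l(w)$ ($k=0$, the empty set, is allowed). Let $\mu$ be Lebesgue measure. The subword $w_S$ of $w$ with respect to $S$ is the timed word of length $\mu(S)$ with associated function $\mathbf w_S(t)=\mathbf w(b_t)$ for $0\le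 t<\mu(S)$, where $b_t$ is the largest number in $[0,l(w))$ such that $\mu(S\cap[0,b_t))=t$. **Greene invariants.** For an integer $r\ge1$, $a_r(w)$ is the supremum of $\mu(S_1)+\dots+\mu(S_r)$ over all $r$-tuples $S_1,\dots,S_r$ of pairwise disjoint time samples of $w$ such that $w_{S_i}$ is a timed row for each $i$. **Knuth equivalence.** Consider the following relations for timed words $x,y,z\in A_n^\dagger$ (with the words whose limits or values are taken nonempty): ($\kappa_1$) $xzy\equiv zxy$ when $xyz$ is a timed row, $l(z)=l(y)$, and $\lim_{t\to l(y)^-}\mathbf y(t)<\mathbf z(0)$; ($\kappa_2$) $yxz\equiv yzx$ when $xyz$ is a timed row, $l(x)=l(y)$, and $\lim_{t\to l(x)^-}\mathbf x(t)<\mathbf y(0)$. A Knuth move on a timed word replaces a segment (factor) of it which is one side of ($\kappa_1$) or ($\kappa_2$) by the other side; that is, it passes between $p\,s\,q$ and $p\,s'\,q$, where $p,q\in A_n^\dagger$ and $s\equiv s'$ is an instance of ($\kappa_1$) or ($\kappa_2$), in either direction. Timed words $w$ and $w'$ are Knuth equivalent, written $w\equiv w'$, if $w$ can be obtained from $w'$ by a finite (possibly empty) sequence of Knuth moves. *)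

theory Defs
  imports "HOL-Analysis.Analysis"
begin

text \<open>
  The sequence \<open>c\<^sub>1\<^bsup>t\<^sub>1\<^esup> \<dots> c\<^sub>k\<^bsup>t\<^sub>k\<^esup>\<close> is the list \<open>[(c\<^sub>1, t\<^sub>1), \<dots>, (c\<^sub>k, t\<^sub>k)]\<close>. A timed word is
  identified with its unique representation in which consecutive letters differ.
\<close>

type_synonym tword = "(nat \<times> real) list"

definition is_tword :: "tword \<Rightarrow> bool" where
  "is_tword w \<longleftrightarrow> (\<forall>(c, t) \<in> set w. 0 < t) \<and> distinct_adj (map fst w)"

definition twords :: "nat \<Rightarrow> tword set" where
  "twords n = {w. is_tword w \<and> fst ` set w \<subseteq> {1..n}}"

fun merge :: "tword \<Rightarrow> tword" where
  "merge [] = []"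
| "merge ((c, t) # w) =
    (case merge w of
       [] \<Rightarrow> [(c, t)]
     | (d, s) # v \<Rightarrow> if c = d then (c, t + s) # v else (c, t) # (d, s) # v)"

definition tconc :: "tword \<Rightarrow> tword \<Rightarrow> tword"  (infixr "\<cdot>\<^sub>t" 65) where
  "u \<cdot>\<^sub>t v = merge (u @ v)"

definition tlen :: "tword \<Rightarrow> real" where
  "tlen w = sum_list (map snd w)"

text \<open>
  The associated function; only its values on \<open>[0, tlen w)\<close> are meaningful. The default value
  outside is not a letter.
\<close>

fun tfun :: "tword \<Rightarrow> real \<Rightarrow> nat" where
  "tfun [] t = 0"
| "tfun ((c, s) # w) t = (if t < s then c else tfun w (t - s))"

definition timed_row :: "tword \<Rightarrow> bool" where
  "timed_row w \<longleftrightarrow> is_tword w \<and> sorted_wrt (<) (map fst w)"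

definition time_sample :: "tword \<Rightarrow> real set \<Rightarrow> bool" where
  "time_sample w S \<longleftrightarrow>
    (\<exists>(k::nat) a b.
       (\<forall>i<k. 0 \<le> a i \<and> a i < b i \<and> b i \<le> tlen w) \<and>
       (\<forall>i. Suc i < k \<longrightarrow> b i < a (Suc i)) \<and>
       S = (\<Union>i<k. {a i..<b i}))"

definition sample_pos :: "tword \<Rightarrow> real set \<Rightarrow> real \<Rightarrow> real" where
  "sample_pos w S t =
    (GREATEST b. b \<in> {0..<tlen w} \<and> measure lborel (S \<inter> {0..<b}) = t)"

text \<open>A timed word is determined by its length and its associated function.\<close>

definition subword :: "tword \<Rightarrow> real set \<Rightarrow> tword" where
  "subword w S =
    (THE v. is_tword v \<and> tlen v = measure lborel S \<and>
       (\<forall>t \<in> {0..<measure lborel S}. tfun v t = tfun w (sample_pos w S t)))"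

definition greene :: "nat \<Rightarrow> tword \<Rightarrow> real" where
  "greene r w =
    Sup {(\<Sum>i<r. measure lborel (S i)) | S.
           (\<forall>i<r. time_sample w (S i) \<and> timed_row (subword w (S i))) \<and>
           disjoint_family_on S {..<r}}"

inductive knuth_rel :: "nat \<Rightarrow> tword \<Rightarrow> tword \<Rightarrow> bool" for n :: nat where
  kappa1: "\<lbrakk>x \<in> twords n; y \<in> twords n; z \<in> twords n; y \<noteq> []; z \<noteq> [];
            timed_row (x \<cdot>\<^sub>t y \<cdot>\<^sub>t z); tlen z = tlen y;
            Lim (at_left (tlen y)) (tfun y) < tfun z 0\<rbrakk>
           \<Longrightarrow> knuth_rel n (x \<cdot>\<^sub>t z \<cdot>\<^sub>t y) (z \<cdot>\<^sub>t x \<cdot>\<^sub>t y)"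
| kappa2: "\<lbrakk>x \<in> twords n; y \<in> twords n; z \<in> twords n; x \<noteq> []; y \<noteq> [];
            timed_row (x \<cdot>\<^sub>t y \<cdot>\<^sub>t z); tlen x = tlen y;
            Lim (at_left (tlen x)) (tfun x) < tfun y 0\<rbrakk>
           \<Longrightarrow> knuth_rel n (y \<cdot>\<^sub>t x \<cdot>\<^sub>t z) (y \<cdot>\<^sub>t z \<cdot>\<^sub>t x)"

definition knuth_move :: "nat \<Rightarrow> tword \<Rightarrow> tword \<Rightarrow> bool" where
  "knuth_move n w w' \<longleftrightarrow>
    (\<exists>p \<in> twords n. \<exists>q \<in> twords n. \<exists>s s'.
       (knuth_rel n s s' \<or> knuth_rel n s' s) \<and> w = p \<cdot>\<^sub>t s \<cdot>\<^sub>t q \<and> w' = p \<cdot>\<^sub>t s' \<cdot>\<^sub>t q)"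

definition knuth_equiv :: "nat \<Rightarrow> tword \<Rightarrow> tword \<Rightarrow> bool" where
  "knuth_equiv n = (knuth_move n)\<^sup>*\<^sup>*"

end

theory Submission
  imports Defs "HOL-Library.Multiset"
begin

text \<open>
  Greene invariants are combinatorial. A subword of \<open>w\<close> is a row exactly when the pieces of \<open>w\<close>
  that its sample meets in positive measure carry weakly increasing letters, and once one of \<open>r\<close>
  disjoint rows uses a piece, it may as well use all of it. So \<open>greene r w\<close> is the largest
  total length of the pieces in a union of \<open>r\<close> disjoint weakly increasing chains of pieces. A
  left-to-right recursion whose state is the multiset of the current last letters of the \<open>r\<close>
  chains computes it (\<open>gain\<close>, \<open>greene_conv_Sup_gain\<close>).

  Knuth moves preserve these numbers. For moves of single pieces this is a case distinction in
  the recursion (\<open>gain_kappa1\<close>, \<open>gain_kappa2\<close>): if one chain uses the two pieces that change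
  places, it exchanges its tail with that of the chain using the third piece. The relations for
  arbitrary rows follow by cutting the rows into sufficiently short pieces
  (\<open>greene_equiv_kappa1\<close>, \<open>greene_equiv_kappa2\<close>). As Knuth equivalence is a congruence, this
  gives one direction of the theorem.

  For the converse, row insertion shows that each timed word is Knuth equivalent to the reading
  word of a tableau (\<open>ex_tableau\<close>). The rows are split off one at a time; the initial segments
  of each row have the lengths of the longest rows of the word with bounded letters, and since
  these lengths are Knuth invariants, consecutive rows satisfy the column condition. A tableau
  can be recovered from Greene invariants in context: if \<open>N\<close> is large, the \<open>r\<close>-th Greene
  invariant of \<open>T k\<^bsup>N\<^esup> (k - 1)\<^bsup>N\<^esup> \<dots> (k - r + 1)\<^bsup>N\<^esup>\<close> is \<open>r N\<close> plus the length of the letters at most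
  \<open>k\<close> in the first \<open>r\<close> rows of \<open>T\<close> (\<open>greene_tableau_staircase\<close>). Indeed, each row of letters
  meets at most one block of the staircase, so an optimal family uses all blocks and hence only
  letters at most \<open>k\<close> of \<open>T\<close>; among those, a row meets each column at most once, and the
  resulting bound is attained. Words with equal Greene invariants in all contexts
  therefore have the same tableau, and are Knuth equivalent.
\<close>

section \<open>Merging and normalisation\<close>

text \<open>
  Adding a piece in front of a word.
\<close>

definition mcons :: "nat \<times> real \<Rightarrow> tword \<Rightarrow> tword" where
  "mcons p v = (case v of [] \<Rightarrow> [p] | q # v' \<Rightarrow>
     if fst p = fst q then (fst p, snd p + snd q) # v' else p # q # v')"

lemma mcons_Nil [simp]: "mcons p [] = [p]"
  by (simp add: mcons_def)

lemma mcons_Cons [simp]: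
  "mcons (c, t) ((d, s) # v) = (if c = d then (c, t + s) # v else (c, t) # (d, s) # v)"
  by (simp add: mcons_def)

lemma merge_Cons: "merge (p # w) = mcons p (merge w)"
  by (cases p) (auto simp: mcons_def split: list.splits)

declare merge.simps(2) [simp del]

lemma merge_append: "merge (u @ v) = foldr mcons u (merge v)"
  by (induction u) (simp_all add: merge_Cons)

lemma merge_distinct_adj: "distinct_adj (map fst w) \<Longrightarrow> merge w = w"
proof (induction w)
  case (Cons p w)
  then have "merge w = w" by (cases w) auto
  with Cons.prems show ?case
    by (cases p; cases w) (auto simp: merge_Cons)
qed simp

lemma distinct_adj_mcons:
  "distinct_adj (map fst v) \<Longrightarrow> distinct_adj (map fst (mcons p v))"
  by (cases p; cases v) auto

lemma distinct_adj_merge: "distinct_adj (map fst (merge w))"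
  by (induction w) (simp_all add: merge_Cons distinct_adj_mcons)

lemma merge_merge [simp]: "merge (merge w) = merge w"
  by (simp add: merge_distinct_adj distinct_adj_merge)

lemma merge_append_merge_right [simp]: "merge (u @ merge v) = merge (u @ v)"
  by (simp add: merge_append)

lemma mcons_mcons_same: "mcons (c, t) (mcons (c, s) Y) = mcons (c, t + s) Y"
  by (cases Y) (auto simp: add.assoc)

lemma foldr_mcons_mcons: "foldr mcons (mcons p v) Y = mcons p (foldr mcons v Y)"
  by (cases p; cases v) (auto simp: mcons_mcons_same)

lemma merge_append_merge_left [simp]: "merge (merge u @ v) = merge (u @ v)"
  unfolding merge_append by (induction u) (simp_all add: merge_Cons foldr_mcons_mcons)

lemma fst_set_merge: "fst ` set (merge w) = fst ` set w"
proof -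
  have "fst ` set (mcons p v) = fst ` set (p # v)" for p v
    by (cases p; cases v) (auto split: if_splits)
  then show ?thesis by (induction w) (simp_all add: merge_Cons)
qed

lemma tlen_simps [simp]: "tlen [] = 0" "tlen (p # w) = snd p + tlen w"
  "tlen (u @ v) = tlen u + tlen v"
  by (simp_all add: tlen_def)

lemma tlen_merge [simp]: "tlen (merge w) = tlen w"
proof -
  have "tlen (mcons p v) = snd p + tlen v" for p v
    by (cases p; cases v) auto
  then show ?thesis by (induction w) (simp_all add: merge_Cons)
qed

lemma set_merge_pos: "\<forall>p\<in>set w. 0 < snd p \<Longrightarrow> \<forall>p\<in>set (merge w). 0 < snd p"
proof (induction w)
  case (Cons p w)
  then have "\<forall>q\<in>set (merge w). 0 < snd q" "0 < snd p" by simp_all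
  then show ?case unfolding merge_Cons by (cases "merge w") (simp_all add: mcons_def)
qed simp

lemma is_tword_iff:
  "is_tword w \<longleftrightarrow> (\<forall>p\<in>set w. 0 < snd p) \<and> distinct_adj (map fst w)"
  by (auto simp: is_tword_def)

lemma is_tword_merge: "\<forall>p\<in>set w. 0 < snd p \<Longrightarrow> is_tword (merge w)"
  by (simp add: is_tword_iff set_merge_pos distinct_adj_merge)

text \<open>
  Intermediate results concern sequences of pieces of nonnegative length in which consecutive
  letters may agree. Such a sequence stands for the timed word obtained from it by
  \<open>norm_word\<close> below.
\<close>

definition nonneg :: "tword \<Rightarrow> bool" where
  "nonneg w \<longleftrightarrow> (\<forall>p\<in>set w. 0 \<le> snd p)"

lemma nonneg_simps [simp]: "nonneg []" "nonneg (p # w) \<longleftrightarrow> 0 \<le> snd p \<and> nonneg w"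
  "nonneg (u @ v) \<longleftrightarrow> nonneg u \<and> nonneg v"
  by (auto simp: nonneg_def)

lemma tlen_nonneg: "nonneg w \<Longrightarrow> 0 \<le> tlen w"
  by (induction w) auto

lemma nonneg_merge: "nonneg w \<Longrightarrow> nonneg (merge w)"
proof (induction w)
  case (Cons p w)
  then show ?case by (cases "merge w") (auto simp: merge_Cons mcons_def)
qed simp

lemma tfun_merge:
  assumes "nonneg w" shows "tfun (merge w) x = tfun w x"
proof -
  have *: "tfun (mcons (c, t) v) x = tfun ((c, t) # v) x" if "nonneg v" "0 \<le> t" for c t v x
    using that by (cases v) (auto simp: algebra_simps)
  from assms show ?thesis
  proof (induction w arbitrary: x)
    case (Cons p w)
    then show ?case by (cases p) (simp add: merge_Cons * nonneg_merge)
  qed simp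
qed

lemma sorted_wrt_less_merge:
  "sorted_wrt (<) (map fst (merge w)) \<longleftrightarrow> sorted (map fst w)"
proof -
  have *: "sorted_wrt (<) (map fst (mcons p v)) \<longleftrightarrow>
      (\<forall>d\<in>fst ` set v. fst p \<le> d) \<and> sorted_wrt (<) (map fst v)" for p v
    by (cases p; cases v) (force simp: order_le_less)+
  show ?thesis
    by (induction w) (auto simp: merge_Cons * fst_set_merge)
qed

text \<open>
  The timed word represented by a sequence: pieces of length zero are dropped, and adjacent
  pieces with equal letters are merged.
\<close>

definition norm_word :: "tword \<Rightarrow> tword" where
  "norm_word w = merge (filter (\<lambda>p. 0 < snd p) w)"

lemma is_tword_norm: "is_tword (norm_word w)"
  by (simp add: norm_word_def is_tword_merge)

lemma norm_word_id: "is_tword w \<Longrightarrow> norm_word w = w"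
  by (simp add: norm_word_def is_tword_iff merge_distinct_adj filter_id_conv)

lemma norm_append: "norm_word (u @ v) = norm_word u \<cdot>\<^sub>t norm_word v"
  by (simp add: norm_word_def tconc_def)

lemma norm_append3: "norm_word (p @ s @ q) = norm_word p \<cdot>\<^sub>t norm_word s \<cdot>\<^sub>t norm_word q"
  by (simp add: norm_append)

lemma tlen_norm [simp]: "nonneg w \<Longrightarrow> tlen (norm_word w) = tlen w"
  unfolding norm_word_def tlen_merge by (induction w) auto

lemma tfun_norm: "nonneg w \<Longrightarrow> tfun (norm_word w) x = tfun w x" if "0 \<le> x"
proof -
  have "nonneg w \<Longrightarrow> tfun (filter (\<lambda>p. 0 < snd p) w) x = tfun w x" 
    using that
  proof (induction w arbitrary: x)
    case (Cons p w)
    then show ?case by (cases p) auto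
  qed simp
  moreover have "nonneg (filter (\<lambda>p. 0 < snd p) w)"
    by (auto simp: nonneg_def)
  ultimately show "nonneg w \<Longrightarrow> tfun (norm_word w) x = tfun w x"
    by (simp add: norm_word_def tfun_merge)
qed

lemma timed_row_norm:
  "timed_row (norm_word w) \<longleftrightarrow> sorted (map fst (filter (\<lambda>p. 0 < snd p) w))"
  using is_tword_norm[of w] by (simp add: timed_row_def norm_word_def sorted_wrt_less_merge)

lemma fst_set_norm: "fst ` set (norm_word w) \<subseteq> fst ` set w"
  by (auto simp: norm_word_def fst_set_merge)

lemma norm_in_twords: "fst ` set w \<subseteq> {1..n} \<Longrightarrow> norm_word w \<in> twords n"
  using fst_set_norm[of w] by (auto simp: twords_def is_tword_norm)

lemma norm_split: "0 \<le> s \<Longrightarrow> 0 \<le> t \<Longrightarrow>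
  norm_word (u @ (c, s + t) # v) = norm_word (u @ (c, s) # (c, t) # v)"
  by (cases "s = 0"; cases "t = 0")
     (simp_all add: norm_word_def merge_append merge_Cons mcons_mcons_same)

lemma tword_unique:
  assumes "is_tword v" "is_tword v'" "tlen v = tlen v'"
    and "\<forall>t\<in>{0..<tlen v}. tfun v t = tfun v' t"
  shows "v = v'"
  using assms
proof (induction v arbitrary: v')
  case Nil
  have "nonneg v'" using Nil by (auto simp: nonneg_def is_tword_iff intro: less_imp_le)
  then show ?case using Nil
    by (cases v') (auto simp: is_tword_iff dest: tlen_nonneg)
next
  case (Cons p u)
  obtain c s where p: "p = (c, s)" by force
  have s: "0 < s" and u: "is_tword u" "u \<noteq> [] \<Longrightarrow> fst (hd u) \<noteq> c" "\<forall>q\<in>set u. 0 < snd q"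
    using Cons.prems(1) p by (auto simp: is_tword_iff distinct_adj_Cons hd_map neq_Nil_conv)
  have nu: "0 \<le> tlen u" using u(3) by (intro tlen_nonneg) (auto simp: nonneg_def less_imp_le)
  have "v' \<noteq> []" using Cons.prems(3) p s nu by auto
  then obtain c' s' u' where v': "v' = (c', s') # u'" by (metis list.exhaust surj_pair)
  have s': "0 < s'" and u': "is_tword u'" "u' \<noteq> [] \<Longrightarrow> fst (hd u') \<noteq> c'" "\<forall>q\<in>set u'. 0 < snd q"
    using Cons.prems(2) v' by (auto simp: is_tword_iff distinct_adj_Cons hd_map neq_Nil_conv)
  have nu': "0 \<le> tlen u'" using u'(3) by (intro tlen_nonneg) (auto simp: nonneg_def less_imp_le)
  have hd0: "tfun u 0 = fst (hd u)" if "u \<noteq> []" "\<forall>q\<in>set u. 0 < snd q" for u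
    using that by (cases u) auto
  have len: "s + tlen u = s' + tlen u'" using Cons.prems(3) p v' by simp
  have eq: "tfun ((c, s) # u) t = tfun ((c', s') # u') t" if "0 \<le> t" "t < s + tlen u" for t
    using Cons.prems(4) that p v' by auto
  have cc: "c = c'" using eq[of 0] s s' nu by auto
  have "s = s'"
  proof (rule ccontr)
    assume "s \<noteq> s'"
    then consider "s < s'" | "s' < s" by linarith
    then show False
    proof cases
      case 1
      then have ne: "u \<noteq> []" using len nu' by auto
      have "tfun u 0 = c'" using eq[of s] 1 s len nu' by simp
      then show False using hd0[OF ne u(3)] u(2)[OF ne] cc by simp
    next
      case 2
      then have ne: "u' \<noteq> []" using len nu by auto
      have "tfun u' 0 = c" using eq[of s'] 2 s' len nu by simp
      then show False using hd0[OF ne u'(3)] u'(2)[OF ne] cc by simp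
    qed
  qed
  moreover have "u = u'"
  proof (rule Cons.IH[OF u(1) u'(1)])
    show "tlen u = tlen u'" using len \<open>s = s'\<close> by simp
    show "\<forall>t\<in>{0..<tlen u}. tfun u t = tfun u' t"
    proof
      fix t assume "t \<in> {0..<tlen u}"
      then show "tfun u t = tfun u' t" using eq[of "s + t"] s \<open>s = s'\<close> by simp
    qed
  qed
  ultimately show ?case using p v' cc by simp
qed

section \<open>Greene invariants as a recursion over pieces\<close>

text \<open>
  \<open>gain w M g\<close> states that disjoint chains of pieces of \<open>w\<close>, one for each element of the
  multiset \<open>M\<close>, can have total length at least \<open>g\<close>, where the chain belonging to \<open>m \<in># M\<close> has
  weakly increasing letters, all at least \<open>m\<close>. Each piece is either left out or appended to one
  chain, whose state becomes the letter of that piece. The letter \<open>0\<close> stands for an empty chain.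
\<close>

fun gain :: "tword \<Rightarrow> nat multiset \<Rightarrow> real \<Rightarrow> bool" where
  "gain [] M g \<longleftrightarrow> g \<le> 0"
| "gain ((c, t) # w) M g \<longleftrightarrow> gain w M g \<or>
     (\<exists>m N. M = add_mset m N \<and> m \<le> c \<and> gain w (add_mset c N) (g - t))"

lemma gain_down: "gain w M g \<Longrightarrow> g' \<le> g \<Longrightarrow> gain w M g'"
proof (induction w M g arbitrary: g' rule: gain.induct)
  case (2 c t w M g)
  from "2.prems"(1) consider "gain w M g" | m N where "M = add_mset m N" "m \<le> c"
    "gain w (add_mset c N) (g - t)" by auto
  then show ?case
  proof cases
    case 1 then show ?thesis using "2.IH"(1) "2.prems"(2) by simp
  next
    case 2
    have "gain w (add_mset c N) (g' - t)"
      using "2.IH"(2)[OF 2(3)] "2.prems"(2) by simp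
    then show ?thesis using 2 by auto
  qed
qed simp

lemma gain_skip: "gain w M g \<Longrightarrow> gain (p # w) M g"
  by (cases p) simp

lemma gain_take:
  "gain w (add_mset c N) (g - t) \<Longrightarrow> m \<le> c \<Longrightarrow> gain ((c, t) # w) (add_mset m N) g"
  by auto

lemma gain_Cons_cases:
  assumes "gain ((c, t) # w) M g"
  obtains "gain w M g"
  | m N where "M = add_mset m N" "m \<le> c" "gain w (add_mset c N) (g - t)"
  using assms by auto

lemma gain_mono:
  "gain w (add_mset c M) g \<Longrightarrow> b \<le> c \<Longrightarrow> gain w (add_mset b M) g"
proof (induction w arbitrary: M b c g)
  case (Cons p w)
  obtain d t where p: "p = (d, t)" by force
  from Cons.prems(1)[unfolded p] show ?case unfolding p
  proof (cases rule: gain_Cons_cases)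
    case 1
    then show "gain ((d, t) # w) (add_mset b M) g" using Cons.IH Cons.prems(2) by (blast intro: gain_skip)
  next
    case (2 m N)
    show "gain ((d, t) # w) (add_mset b M) g"
    proof (cases "m = c \<and> N = M")
      case True
      then show ?thesis using 2 Cons.prems(2) by - (rule gain_take[where m = b], auto)
    next
      case False
      then obtain N' where N: "N = add_mset c N'" "M = add_mset m N'"
        using 2(1) by (auto simp: add_eq_conv_ex)
      have "gain w (add_mset b (add_mset d N')) (g - t)"
        using 2(3) N Cons.IH[of c "add_mset d N'" "g - t" b] Cons.prems(2)
        by (simp add: add_mset_commute)
      then have "gain ((d, t) # w) (add_mset m (add_mset b N')) g"
        using 2(2) by - (rule gain_take, simp_all add: add_mset_commute)
      then show ?thesis using N by (simp add: add_mset_commute)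
    qed
  qed
qed simp

lemma gain_prepend:
  assumes "\<And>M g. gain x M g = gain y M g"
  shows "gain (p @ x) M g = gain (p @ y) M g"
  by (induction p arbitrary: M g) (use assms in auto)

lemma gain_swap:
  assumes "gain ((c, t) # (a, s) # w) M g" "a < c"
  shows "gain ((a, s) # (c, t) # w) M g"
  using assms(1)
proof (cases rule: gain_Cons_cases)
  case 1
  from 1 show ?thesis
  proof (cases rule: gain_Cons_cases)
    case 1
    then show ?thesis by simp
  next
    case (2 m N)
    then show ?thesis by (auto)
  qed
next
  case (2 m N)
  from 2(3) show ?thesis
  proof (cases rule: gain_Cons_cases)
    case 1
    then show ?thesis using 2 by auto
  next
    case (2 m' N')
    then obtain K where "N = add_mset m' K" "N' = add_mset c K"
      using assms(2) by (auto simp: add_eq_conv_ex)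
    then have "gain ((c, t) # w) (add_mset m (add_mset a K)) (g - s)"
      using 2 \<open>m \<le> c\<close> by - (rule gain_take, simp_all add: add_mset_commute algebra_simps)
    then have "gain ((a, s) # (c, t) # w) (add_mset m' (add_mset m K)) g"
      using 2(2) by - (rule gain_take, simp_all add: add_mset_commute)
    then show ?thesis using \<open>M = _\<close> \<open>N = _\<close> by (simp add: add_mset_commute)
  qed
qed

text \<open>
  The tail exchange. If one chain contains \<open>a\<close> followed by \<open>c\<close> in \<open>a c b\<close>, then in \<open>c a b\<close> it
  takes \<open>a\<close> and \<open>b\<close> instead; a chain that contained \<open>b\<close> takes \<open>c\<close>, and the two
  chains exchange their continuations. If \<open>b\<close> was unused, it simply replaces \<open>c\<close>.
\<close>

lemma gain_kappa1:
  assumes "a \<le> b" "b < c"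
  shows "gain ((a, s) # (c, t) # (b, t) # v) M g \<longleftrightarrow> gain ((c, t) # (a, s) # (b, t) # v) M g"
proof
  assume "gain ((a, s) # (c, t) # (b, t) # v) M g"
  then show "gain ((c, t) # (a, s) # (b, t) # v) M g"
  proof (cases rule: gain_Cons_cases)
    case 1
    then show ?thesis by (cases rule: gain_Cons_cases) (auto intro: gain_skip gain_take simp del: gain.simps)
  next
    case A: (2 m N)
    from A(3) show ?thesis
    proof (cases rule: gain_Cons_cases)
      case 1
      then show ?thesis using A by (auto intro!: gain_skip[of _ _ _ "(c, t)"] gain_take simp del: gain.simps)
    next
      case C: (2 m2 N2)
      show ?thesis
      proof (cases "m2 = a \<and> N2 = N")
        case False
        then obtain K where K: "N = add_mset m2 K" "N2 = add_mset a K"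
          using C(1) by (auto simp: add_eq_conv_ex)
        have "gain ((a, s) # (b, t) # v) (add_mset m (add_mset c K)) (g - t)"
          using A C K by - (rule gain_take, simp_all add: add_mset_commute algebra_simps del: gain.simps)
        then have "gain ((c, t) # (a, s) # (b, t) # v) (add_mset m2 (add_mset m K)) g"
          using C by - (rule gain_take, simp_all add: add_mset_commute del: gain.simps)
        then show ?thesis using A K by (simp add: add_mset_commute del: gain.simps)
      next
        case True
        have "gain ((b, t) # v) (add_mset c N) (g - s - t)" using C True by simp
        then show ?thesis
        proof (cases rule: gain_Cons_cases)
          case 1
          then have "gain v (add_mset b N) (g - s - t)" using gain_mono assms by (meson less_imp_le)
          then have "gain ((a, s) # (b, t) # v) (add_mset m N) g"
            using A assms by - (rule gain_take, auto)
          then show ?thesis using A by (simp add: gain_skip del: gain.simps)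
        next
          case B: (2 m3 N3)
          then obtain K where K: "N = add_mset m3 K" "N3 = add_mset c K"
            using assms by (auto simp: add_eq_conv_ex)
          have "gain ((b, t) # v) (add_mset a (add_mset c K)) (g - t - s)"
            using B K assms by - (rule gain_take, simp_all add: algebra_simps)
          then have "gain ((a, s) # (b, t) # v) (add_mset m (add_mset c K)) (g - t)"
            using A by - (rule gain_take, auto)
          then have "gain ((c, t) # (a, s) # (b, t) # v) (add_mset m3 (add_mset m K)) g"
            using B assms by - (rule gain_take, simp_all add: add_mset_commute del: gain.simps)
          then show ?thesis using A K by (simp add: add_mset_commute del: gain.simps)
        qed
      qed
    qed
  qed
qed (rule gain_swap, use assms in simp_all)

text \<open>
  The dual exchange. If one chain contains \<open>a\<close> followed by \<open>c\<close> in \<open>b a c\<close>, then in \<open>b c a\<close> the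
  letter \<open>c\<close> follows \<open>b\<close> instead: a chain that contained \<open>b\<close> continues from \<open>b\<close> with \<open>c\<close> and what came
  after it, and the first chain continues from \<open>a\<close> as that chain did. If \<open>b\<close> was unused, it
  replaces \<open>a\<close>.
\<close>

lemma gain_kappa2:
  assumes "a < b" "b \<le> c"
  shows "gain ((b, t) # (a, t) # (c, s) # v) M g \<longleftrightarrow> gain ((b, t) # (c, s) # (a, t) # v) M g"
proof
  assume "gain ((b, t) # (c, s) # (a, t) # v) M g"
  moreover have "gain ((a, t) # (c, s) # v) M g" if "gain ((c, s) # (a, t) # v) M g" for M g
    by (rule gain_swap[OF that]) (use assms in simp)
  ultimately show "gain ((b, t) # (a, t) # (c, s) # v) M g"
    by (auto elim!: gain_Cons_cases[of b] intro: gain_skip gain_take simp del: gain.simps)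
next
  assume "gain ((b, t) # (a, t) # (c, s) # v) M g"
  then show "gain ((b, t) # (c, s) # (a, t) # v) M g"
  proof (cases rule: gain_Cons_cases)
    case 1
    then show ?thesis
    proof (cases rule: gain_Cons_cases)
      case 1
      then show ?thesis by (cases rule: gain_Cons_cases) (auto intro: gain_skip gain_take simp del: gain.simps)
    next
      case A: (2 m N)
      from A(3) show ?thesis
      proof (cases rule: gain_Cons_cases)
        case 1
        then show ?thesis using A by (auto intro: gain_skip gain_take simp del: gain.simps)
      next
        case C: (2 m2 N2)
        show ?thesis
        proof (cases "m2 = a \<and> N2 = N")
          case True
          have "gain ((c, s) # (a, t) # v) (add_mset b N) (g - t)"
            using C True assms by (intro gain_take[where c=c] gain_skip) auto
          then show ?thesis using A assms by (auto intro: gain_take simp del: gain.simps)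
        next
          case False
          then obtain K where K: "N = add_mset m2 K" "N2 = add_mset a K"
            using C(1) by (auto simp: add_eq_conv_ex)
          have "gain ((a, t) # v) (add_mset m (add_mset c K)) (g - s)"
            using A C K by - (rule gain_take, simp_all add: add_mset_commute algebra_simps del: gain.simps)
          then have "gain ((c, s) # (a, t) # v) (add_mset m2 (add_mset m K)) g"
            using C by - (rule gain_take, simp_all add: add_mset_commute del: gain.simps)
          then show ?thesis using A K by (simp add: add_mset_commute gain_skip del: gain.simps)
        qed
      qed
    qed
  next
    case B: (2 m1 N1)
    from B(3) show ?thesis
    proof (cases rule: gain_Cons_cases)
      case 1
      then have "gain ((c, s) # (a, t) # v) (add_mset b N1) (g - t)"
        by (cases rule: gain_Cons_cases) (auto intro: gain_skip gain_take simp del: gain.simps)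
      then show ?thesis using B by (auto intro: gain_take simp del: gain.simps)
    next
      case A: (2 m2 N2)
      then obtain K where K: "N1 = add_mset m2 K" "N2 = add_mset b K"
        using assms by (auto simp: add_eq_conv_ex)
      from A(3) have "gain ((c, s) # (a, t) # v) (add_mset b N1) (g - t)"
      proof (cases rule: gain_Cons_cases)
        case 1
        then have "gain ((a, t) # v) (add_mset m2 (add_mset b K)) (g - t)"
          using A K by - (rule gain_take, simp_all add: add_mset_commute)
        then show ?thesis using K by (simp add: add_mset_commute gain_skip del: gain.simps)
      next
        case C: (2 m3 N3)
        show ?thesis
        proof (cases "m3 = a \<and> N3 = N2")
          case True
          then have "gain v (add_mset a (add_mset c K)) (g - t - t - s)"
            using C K assms by - (rule gain_mono[of _ b], auto simp: add_mset_commute)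
          then have "gain ((a, t) # v) (add_mset m2 (add_mset c K)) (g - t - s)"
            using A by - (rule gain_take, simp_all add: algebra_simps)
          then have "gain ((c, s) # (a, t) # v) (add_mset b (add_mset m2 K)) (g - t)"
            using assms by - (rule gain_take, simp_all add: add_mset_commute del: gain.simps)
          then show ?thesis using K by simp
        next
          case False
          then obtain L where L: "N2 = add_mset m3 L" "N3 = add_mset a L"
            using C(1) by (auto simp: add_eq_conv_ex)
          have "gain ((a, t) # v) (add_mset m2 (add_mset c L)) (g - t - s)"
            using A C L by - (rule gain_take, simp_all add: add_mset_commute algebra_simps)
          then have "gain ((c, s) # (a, t) # v) (add_mset m3 (add_mset m2 L)) (g - t)"
            using C by - (rule gain_take, simp_all add: add_mset_commute del: gain.simps)
          moreover have "add_mset m3 (add_mset m2 L) = add_mset b N1"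
            using K L by (metis add_mset_commute)
          ultimately show ?thesis by simp
        qed
      qed
      then show ?thesis using B by (auto intro: gain_take simp del: gain.simps)
    qed
  qed
qed

text \<open>
  Two chains sharing the halves of a piece can do no better than one chain taking all of it.
\<close>

lemma gain_split:
  assumes "0 \<le> s" "0 \<le> t"
  shows "gain ((c, s + t) # w) M g \<longleftrightarrow> gain ((c, s) # (c, t) # w) M g"
proof
  assume "gain ((c, s + t) # w) M g"
  then show "gain ((c, s) # (c, t) # w) M g"
  proof (cases rule: gain_Cons_cases)
    case (2 m N)
    then have "gain ((c, t) # w) (add_mset c N) (g - s)"
      by - (rule gain_take, simp_all add: algebra_simps)
    then show ?thesis using 2 by (auto intro: gain_take simp del: gain.simps)
  qed (simp add: gain_skip)
next
  assume "gain ((c, s) # (c, t) # w) M g"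
  then show "gain ((c, s + t) # w) M g"
  proof (cases rule: gain_Cons_cases)
    case 1
    then show ?thesis
    proof (cases rule: gain_Cons_cases)
      case (2 m N)
      then have "gain w (add_mset c N) (g - (s + t))" using assms gain_down[of w _ "g - t"] by auto
      then show ?thesis using 2 by auto
    qed (simp add: gain_skip)
  next
    case S: (2 m N)
    from S(3) show ?thesis
    proof (cases rule: gain_Cons_cases)
      case 1
      then have "gain w (add_mset c N) (g - (s + t))" using assms gain_down[of w _ "g - s"] by auto
      then show ?thesis using S by auto
    next
      case (2 m2 N2)
      then have g: "gain w (add_mset c N2) (g - (s + t))" by (simp add: algebra_simps)
      show ?thesis
      proof (cases "m2 = c \<and> N2 = N")
        case True
        then show ?thesis using g S by auto
      next
        case False
        then obtain K where K: "N = add_mset m2 K" "N2 = add_mset c K"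
          using 2(1) by (auto simp: add_eq_conv_ex)
        then have "gain w (add_mset c (add_mset m2 K)) (g - (s + t))"
          using g 2(2) gain_mono[of w c "add_mset c K" _ m2] by (simp add: add_mset_commute)
        then have "gain ((c, s + t) # w) (add_mset m (add_mset m2 K)) g"
          using S by - (rule gain_take, simp_all)
        then show ?thesis using K S by simp
      qed
    qed
  qed
qed

lemma gain_le_tlen: "nonneg w \<Longrightarrow> gain w M g \<Longrightarrow> g \<le> tlen w"
proof (induction w arbitrary: M g)
  case (Cons p w)
  obtain c t where p: "p = (c, t)" by force
  from Cons.prems(2)[unfolded p] show ?case
    by (cases rule: gain_Cons_cases) (use Cons p in fastforce)+
qed simp

lemma gain_filter: "gain (filter P w @ v) M g \<Longrightarrow> gain (w @ v) M g"
proof (induction w arbitrary: M g)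
  case (Cons p w)
  then show ?case by (cases p) (auto split: if_splits)
qed simp

section \<open>Knuth relations preserve the recursion\<close>

text \<open>
  If \<open>f k\<close> is the maximal length of a row with letters at most \<open>k\<close> in some word, then
  \<open>row_step f p\<close> is the corresponding function for the word extended by the piece \<open>p\<close>.
\<close>

definition row_step :: "(nat \<Rightarrow> real) \<Rightarrow> nat \<times> real \<Rightarrow> nat \<Rightarrow> real" where
  "row_step f p = (\<lambda>k. if k < fst p then f k else max (f k) (f (fst p) + snd p))"

lemma mono_row_step: "mono f \<Longrightarrow> mono (row_step f p)"
proof (rule monoI)
  fix x y :: nat assume f: "mono f" and "x \<le> y"
  then have "f x \<le> f y" by (simp add: monoD)
  moreover have "fst p \<le> x \<or> y < fst p \<or> x < fst p \<and> fst p \<le> y" by linarith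
  ultimately show "row_step f p x \<le> row_step f p y"
    using \<open>x \<le> y\<close> by (auto simp: row_step_def)
qed

lemma mono_foldl_row_step: "mono f \<Longrightarrow> mono (foldl row_step f w)"
  by (induction w arbitrary: f) (simp_all add: mono_row_step)

text \<open>
  Equality of the two kinds of invariants needed: the maximal lengths of unions of disjoint
  rows, for all initial states and all right contexts, and the maximal lengths of single rows
  with bounded letters, for all monotone initial functions. Left contexts are then automatically respected
  (\<open>greene_equiv_append\<close>).
\<close>

definition greene_equiv :: "tword \<Rightarrow> tword \<Rightarrow> bool"  (infix "\<approx>\<^sub>G" 50) where
  "w \<approx>\<^sub>G w' \<longleftrightarrow> (\<forall>v M g. gain (w @ v) M g \<longleftrightarrow> gain (w' @ v) M g) \<and>
     (\<forall>f. mono f \<longrightarrow> foldl row_step f w = foldl row_step f w')"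

lemma greene_equiv_refl [simp]: "w \<approx>\<^sub>G w"
  by (simp add: greene_equiv_def)

lemma greene_equiv_sym: "w \<approx>\<^sub>G w' \<Longrightarrow> w' \<approx>\<^sub>G w"
  by (simp add: greene_equiv_def)

lemma greene_equiv_trans [trans]: "u \<approx>\<^sub>G v \<Longrightarrow> v \<approx>\<^sub>G w \<Longrightarrow> u \<approx>\<^sub>G w"
  by (simp add: greene_equiv_def)

lemma greene_equiv_append: "s \<approx>\<^sub>G s' \<Longrightarrow> p @ s @ q \<approx>\<^sub>G p @ s' @ q"
  unfolding greene_equiv_def append_assoc foldl_append
  by (simp add: mono_foldl_row_step)
     (metis gain_prepend[of "s @ w" "s' @ w" p for w])

lemma greene_equiv_appendL: "s \<approx>\<^sub>G s' \<Longrightarrow> p @ s \<approx>\<^sub>G p @ s'"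
  using greene_equiv_append[of s s' p "[]"] by simp

lemma greene_equiv_appendR: "s \<approx>\<^sub>G s' \<Longrightarrow> s @ q \<approx>\<^sub>G s' @ q"
  using greene_equiv_append[of s s' "[]" q] by simp

lemma greene_equiv_Cons: "s \<approx>\<^sub>G s' \<Longrightarrow> p # s \<approx>\<^sub>G p # s'"
  using greene_equiv_appendL[of s s' "[p]"] by simp

lemma row_step_kappa1:
  assumes "mono f" "a \<le> b" "b < c"
  shows "foldl row_step f [(a, s), (c, t), (b, t)] = foldl row_step f [(c, t), (a, s), (b, t)]"
proof
  fix k
  have "f a \<le> f b" "f b \<le> f c" "k \<le> a \<Longrightarrow> f k \<le> f a" "a \<le> k \<Longrightarrow> f a \<le> f k"
    "b \<le> k \<Longrightarrow> f b \<le> f k" "c \<le> k \<Longrightarrow> f c \<le> f k"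
    using assms by (simp_all add: monoD)
  with assms(2,3) show "foldl row_step f [(a, s), (c, t), (b, t)] k =
      foldl row_step f [(c, t), (a, s), (b, t)] k"
    by (simp add: row_step_def max_def)
qed

lemma row_step_kappa2:
  assumes "mono f" "a < b" "b \<le> c"
  shows "foldl row_step f [(b, t), (a, t), (c, s)] = foldl row_step f [(b, t), (c, s), (a, t)]"
proof
  fix k
  have "f a \<le> f b" "f b \<le> f c" "a \<le> k \<Longrightarrow> f a \<le> f k"
    "b \<le> k \<Longrightarrow> f b \<le> f k" "c \<le> k \<Longrightarrow> f c \<le> f k"
    using assms by (simp_all add: monoD)
  with assms(2,3) show "foldl row_step f [(b, t), (a, t), (c, s)] k =
      foldl row_step f [(b, t), (c, s), (a, t)] k"
    by (simp add: row_step_def max_def)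
qed

lemma greene_equiv_kappa1_single:
  "a \<le> b \<Longrightarrow> b < c \<Longrightarrow> [(a, s), (c, t), (b, t)] \<approx>\<^sub>G [(c, t), (a, s), (b, t)]"
  unfolding greene_equiv_def append_Cons append_Nil using gain_kappa1 row_step_kappa1 by blast

lemma greene_equiv_kappa2_single:
  "a < b \<Longrightarrow> b \<le> c \<Longrightarrow> [(b, t), (a, t), (c, s)] \<approx>\<^sub>G [(b, t), (c, s), (a, t)]"
  unfolding greene_equiv_def append_Cons append_Nil using gain_kappa2 row_step_kappa2 by blast

lemma greene_equiv_split:
  assumes "0 \<le> s" "0 \<le> t" shows "[(c, s + t)] \<approx>\<^sub>G [(c, s), (c, t)]"
proof -
  have "row_step f (c, s + t) = row_step (row_step f (c, s)) (c, t)" for f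
    using assms by (auto simp: row_step_def fun_eq_iff max_def)
  then show ?thesis unfolding greene_equiv_def using gain_split[OF assms]
    by (simp del: gain.simps)
qed

lemma greene_equiv_zero:
  "[(c, 0)] \<approx>\<^sub>G []"
proof -
  have "gain ((c, 0) # v) M g \<longleftrightarrow> gain v M g" for v M g
    by (auto intro: gain_mono)
  moreover have "mono f \<Longrightarrow> row_step f (c, 0) = f" for f
    by (auto simp: row_step_def fun_eq_iff max_def mono_def not_less intro: antisym)
  ultimately show ?thesis by (simp add: greene_equiv_def del: gain.simps)
qed

lemma greene_equiv_mcons: "0 \<le> snd p \<Longrightarrow> nonneg v \<Longrightarrow> mcons p v \<approx>\<^sub>G p # v"
proof (cases v)
  case (Cons q v')
  assume "0 \<le> snd p" "nonneg v"
  then show ?thesis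
    using greene_equiv_appendR[OF greene_equiv_split[of "snd p" "snd q" "fst q"], of v'] Cons
    by (cases p; cases q) auto
qed simp

lemma greene_equiv_merge: "nonneg w \<Longrightarrow> merge w \<approx>\<^sub>G w"
proof (induction w)
  case (Cons p w)
  then have "merge (p # w) \<approx>\<^sub>G p # merge w"
    by (simp add: merge_Cons greene_equiv_mcons nonneg_merge)
  also have "\<dots> \<approx>\<^sub>G p # w" using Cons by (simp add: greene_equiv_Cons)
  finally show ?case .
qed simp

lemma greene_equiv_norm: "nonneg w \<Longrightarrow> norm_word w \<approx>\<^sub>G w"
proof -
  assume w: "nonneg w"
  have "norm_word w \<approx>\<^sub>G filter (\<lambda>p. 0 < snd p) w"
    unfolding norm_word_def by (rule greene_equiv_merge) (auto simp: nonneg_def)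
  also have "\<dots> \<approx>\<^sub>G w" using w
  proof (induction w)
    case (Cons p w)
    show ?case
    proof (cases "0 < snd p")
      case True
      then show ?thesis using Cons by (simp add: greene_equiv_Cons)
    next
      case False
      then have p: "p = (fst p, 0)" using Cons.prems by (cases p) auto
      have "filter (\<lambda>p. 0 < snd p) (p # w) \<approx>\<^sub>G w" using False Cons by simp
      also have "w \<approx>\<^sub>G p # w"
        using greene_equiv_appendR[OF greene_equiv_zero[of "fst p"], of w] p
        by (metis append_Cons append_Nil greene_equiv_sym)
      finally show ?thesis .
    qed
  qed simp
  finally show ?thesis .
qed

text \<open>
  If every piece of the row \<open>x\<close> has length at least \<open>t\<close>, the piece \<open>c\<^sup>t\<close> passes the pieces of
  \<open>x\<close> one at a time: the first \<open>t\<close> units of the next piece play the part of the smaller letter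
  that the relation requires.
\<close>

lemma greene_equiv_kappa1_thin:
  assumes "0 \<le> t" "b < c" "sorted (map fst x)" "\<forall>p\<in>set x. fst p \<le> b \<and> t \<le> snd p"
  shows "x @ [(c, t), (b, t)] \<approx>\<^sub>G (c, t) # x @ [(b, t)]"
  using assms(3,4)
proof (induction x)
  case (Cons p x)
  obtain a s where p: "p = (a, s)" by force
  from Cons.prems p have a: "a \<le> b" by simp
  obtain e s' y where y: "x @ [(b, t)] = (e, s') # y" by (cases "x @ [(b, t)]") auto
  have e: "a \<le> e" "e < c" "t \<le> s'"
    using y Cons.prems p assms(2) by (cases x; force)+
  have "p # x @ [(c, t), (b, t)] \<approx>\<^sub>G [p] @ (c, t) # x @ [(b, t)]"
    using Cons by (simp add: greene_equiv_Cons)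
  also have "[p] @ (c, t) # x @ [(b, t)] = [p, (c, t)] @ [(e, t + (s' - t))] @ y"
    using y by simp
  also have "\<dots> \<approx>\<^sub>G [p, (c, t)] @ [(e, t), (e, s' - t)] @ y"
    by (rule greene_equiv_append[OF greene_equiv_split]) (use assms(1) e in auto)
  also have "\<dots> = [(a, s), (c, t), (e, t)] @ (e, s' - t) # y" using p by simp
  also have "\<dots> \<approx>\<^sub>G [(c, t), (a, s), (e, t)] @ (e, s' - t) # y"
    by (rule greene_equiv_appendR[OF greene_equiv_kappa1_single]) (use e in auto)
  also have "\<dots> = [(c, t), (a, s)] @ [(e, t), (e, s' - t)] @ y" by simp
  also have "\<dots> \<approx>\<^sub>G [(c, t), (a, s)] @ [(e, t + (s' - t))] @ y"
    by (rule greene_equiv_sym[OF greene_equiv_append[OF greene_equiv_split]]) (use assms(1) e in auto)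
  also have "\<dots> = (c, t) # (p # x) @ [(b, t)]" using p y by simp
  finally show ?case by simp
qed simp

lemma greene_equiv_kappa2_thin:
  assumes "0 \<le> t" "a < b" "sorted (map fst z)" "\<forall>p\<in>set z. b \<le> fst p \<and> t \<le> snd p"
  shows "[(b, t), (a, t)] @ z \<approx>\<^sub>G (b, t) # z @ [(a, t)]"
  using assms(3,4)
proof (induction z rule: rev_induct)
  case (snoc p z)
  obtain d s where p: "p = (d, s)" by force
  obtain e s' y where y: "(b, t) # z = y @ [(e, s')]"
    by (cases "(b, t) # z" rule: rev_cases) auto
  have e: "a < e" "e \<le> d" "t \<le> s'"
    using y snoc.prems p assms(2) by (cases z rule: rev_cases; force simp: sorted_append)+
  have "([(b, t), (a, t)] @ z) @ [p] \<approx>\<^sub>G ((b, t) # z @ [(a, t)]) @ [p]"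
    by (rule greene_equiv_appendR) (use snoc in \<open>simp add: sorted_append\<close>)
  also have "((b, t) # z @ [(a, t)]) @ [p] = y @ [(e, (s' - t) + t)] @ [(a, t), p]"
    using y by simp
  also have "\<dots> \<approx>\<^sub>G y @ [(e, s' - t), (e, t)] @ [(a, t), p]"
    by (rule greene_equiv_append[OF greene_equiv_split]) (use assms(1) e in auto)
  also have "\<dots> = (y @ [(e, s' - t)]) @ [(e, t), (a, t), (d, s)]" using p by simp
  also have "\<dots> \<approx>\<^sub>G (y @ [(e, s' - t)]) @ [(e, t), (d, s), (a, t)]"
    by (rule greene_equiv_appendL[OF greene_equiv_kappa2_single]) (use e in auto)
  also have "\<dots> = y @ [(e, s' - t), (e, t)] @ [(d, s), (a, t)]" by simp
  also have "\<dots> \<approx>\<^sub>G y @ [(e, (s' - t) + t)] @ [(d, s), (a, t)]"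
    by (rule greene_equiv_sym[OF greene_equiv_append[OF greene_equiv_split]]) (use assms(1) e in auto)
  also have "\<dots> = (b, t) # (z @ [p]) @ [(a, t)]" using p y by simp
  finally show ?case by simp
qed simp

lemma greene_equiv_split_mult:
  "0 \<le> d \<Longrightarrow> [(c, real (Suc N) * d)] \<approx>\<^sub>G [(c, d), (c, real N * d)]"
  "0 \<le> d \<Longrightarrow> [(c, real (Suc N) * d)] \<approx>\<^sub>G [(c, real N * d), (c, d)]"
  using greene_equiv_split[of d "real N * d" c] greene_equiv_split[of "real N * d" d c]
  by (simp_all add: algebra_simps)

lemma ex_fine_fraction:
  assumes "0 < t" "\<forall>p\<in>set x. 0 < snd p"
  obtains N :: nat and d :: real where "0 < d" "t = real N * d" "\<forall>p\<in>set x. d \<le> snd p"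
proof -
  define m where "m = Min (insert t (snd ` set x))"
  have m: "0 < m" "\<forall>p\<in>set x. m \<le> snd p" using assms by (auto simp: m_def)
  obtain N :: nat where N: "t / m < real N" using reals_Archimedean2 by blast
  then have "0 < real N" using assms(1) m(1)
    by (smt (verit) divide_pos_pos)
  moreover have "t / real N < m" using N m(1) \<open>0 < real N\<close> by (simp add: field_simps)
  ultimately show thesis using m(2) assms(1)
    by (intro that[of "t / real N" N]) fastforce+
qed

text \<open>
  The length condition is removed by cutting \<open>c\<^sup>t\<close> and \<open>b\<^sup>t\<close> into \<open>N\<close> short parts of length \<open>d\<close>
  and moving the parts of \<open>c\<^sup>t\<close> one by one; each part of \<open>b\<^sup>t\<close> that has been used is absorbed
  into \<open>x\<close>.
\<close>

lemma greene_equiv_kappa1_one: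
  assumes "0 < t" "b < c" "sorted (map fst x)" "\<forall>p\<in>set x. fst p \<le> b \<and> 0 < snd p"
  shows "x @ [(c, t), (b, t)] \<approx>\<^sub>G (c, t) # x @ [(b, t)]"
proof -
  obtain N :: nat and d :: real where d: "0 < d" "t = real N * d" "\<forall>p\<in>set x. d \<le> snd p"
    using ex_fine_fraction[of t x] assms by blast
  have "x @ [(c, real N * d), (b, real N * d)] \<approx>\<^sub>G (c, real N * d) # x @ [(b, real N * d)]"
    using assms(3,4) d(3)
  proof (induction N arbitrary: x)
    case 0
    have z: "[(c, 0)] \<approx>\<^sub>G []" for c by (rule greene_equiv_zero)
    have "x @ [(c, 0)] @ [(b, 0)] \<approx>\<^sub>G x @ [] @ [(b, 0)]" by (rule greene_equiv_append[OF z])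
    also have "x @ [] @ [(b, 0)] = [] @ x @ [(b, 0)]" by simp
    also have "\<dots> \<approx>\<^sub>G [(c, 0)] @ x @ [(b, 0)]" by (rule greene_equiv_appendR[OF greene_equiv_sym[OF z]])
    finally show ?case by simp
  next
    case (Suc N)
    let ?C = "[(c, real N * d)]" and ?B = "[(b, real N * d)]"
    have "x @ [(c, real (Suc N) * d), (b, real (Suc N) * d)] =
        x @ [(c, real (Suc N) * d)] @ [(b, real (Suc N) * d)]" by simp
    also have "\<dots> \<approx>\<^sub>G x @ [(c, d), (c, real N * d)] @ [(b, real (Suc N) * d)]"
      by (rule greene_equiv_append[OF greene_equiv_split_mult(1)]) (use d in simp)
    also have "\<dots> = (x @ [(c, d), (c, real N * d)]) @ [(b, real (Suc N) * d)]" by simp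
    also have "\<dots> \<approx>\<^sub>G (x @ [(c, d), (c, real N * d)]) @ [(b, d), (b, real N * d)]"
      by (rule greene_equiv_appendL[OF greene_equiv_split_mult(1)]) (use d in simp)
    also have "\<dots> = x @ [(c, d), (c, real N * d), (b, d)] @ ?B" by simp
    also have "\<dots> \<approx>\<^sub>G x @ [(c, d), (b, d), (c, real N * d)] @ ?B"
      by (rule greene_equiv_append[OF greene_equiv_sym[OF greene_equiv_kappa2_single]]) (use assms(2) in auto)
    also have "\<dots> = (x @ [(c, d), (b, d)]) @ ?C @ ?B" by simp
    also have "\<dots> \<approx>\<^sub>G ((c, d) # x @ [(b, d)]) @ ?C @ ?B"
      by (rule greene_equiv_appendR[OF greene_equiv_kappa1_thin]) (use assms(2) d Suc.prems in auto)
    also have "\<dots> = [(c, d)] @ ((x @ [(b, d)]) @ [(c, real N * d), (b, real N * d)])" by simp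
    also have "\<dots> \<approx>\<^sub>G [(c, d)] @ ((c, real N * d) # (x @ [(b, d)]) @ [(b, real N * d)])"
      by (rule greene_equiv_appendL[OF Suc.IH]) (use Suc.prems d in \<open>auto simp: sorted_append\<close>)
    also have "\<dots> = ([(c, d), (c, real N * d)] @ x) @ [(b, d), (b, real N * d)]" by simp
    also have "\<dots> \<approx>\<^sub>G ([(c, d), (c, real N * d)] @ x) @ [(b, real (Suc N) * d)]"
      by (rule greene_equiv_appendL[OF greene_equiv_sym[OF greene_equiv_split_mult(1)]]) (use d in simp)
    also have "\<dots> = [(c, d), (c, real N * d)] @ (x @ [(b, real (Suc N) * d)])" by simp
    also have "\<dots> \<approx>\<^sub>G [(c, real (Suc N) * d)] @ (x @ [(b, real (Suc N) * d)])"
      by (rule greene_equiv_appendR[OF greene_equiv_sym[OF greene_equiv_split_mult(1)]]) (use d in simp)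
    finally show ?case by simp
  qed
  with d(2) show ?thesis by simp
qed

lemma greene_equiv_kappa2_one:
  assumes "0 < t" "a < b" "sorted (map fst z)" "\<forall>p\<in>set z. b \<le> fst p \<and> 0 < snd p"
  shows "[(b, t), (a, t)] @ z \<approx>\<^sub>G (b, t) # z @ [(a, t)]"
proof -
  obtain N :: nat and d :: real where d: "0 < d" "t = real N * d" "\<forall>p\<in>set z. d \<le> snd p"
    using ex_fine_fraction[of t z] assms by blast
  have "[(b, real N * d), (a, real N * d)] @ z \<approx>\<^sub>G (b, real N * d) # z @ [(a, real N * d)]"
    using assms(3,4) d(3)
  proof (induction N arbitrary: z)
    case 0
    have z: "[(c, 0)] \<approx>\<^sub>G []" for c by (rule greene_equiv_zero)
    have "[(b, 0)] @ [(a, 0)] @ z \<approx>\<^sub>G [(b, 0)] @ [] @ z" by (rule greene_equiv_append[OF z])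
    also have "[(b, 0)] @ [] @ z = ((b, 0) # z) @ []" by simp
    also have "\<dots> \<approx>\<^sub>G ((b, 0) # z) @ [(a, 0)]" by (rule greene_equiv_appendL[OF greene_equiv_sym[OF z]])
    finally show ?case by simp
  next
    case (Suc N)
    let ?A = "[(a, real N * d)]" and ?B = "[(b, real N * d)]"
    have "[(b, real (Suc N) * d), (a, real (Suc N) * d)] @ z =
        [(b, real (Suc N) * d)] @ [(a, real (Suc N) * d)] @ z" by simp
    also have "\<dots> \<approx>\<^sub>G [(b, real (Suc N) * d)] @ [(a, real N * d), (a, d)] @ z"
      by (rule greene_equiv_append[OF greene_equiv_split_mult(2)]) (use d in simp)
    also have "\<dots> \<approx>\<^sub>G [(b, real N * d), (b, d)] @ [(a, real N * d), (a, d)] @ z"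
      by (rule greene_equiv_appendR[OF greene_equiv_split_mult(2)]) (use d in simp)
    also have "\<dots> = ?B @ [(b, d), (a, real N * d), (a, d)] @ z" by simp
    also have "\<dots> \<approx>\<^sub>G ?B @ [(a, real N * d), (b, d), (a, d)] @ z"
      by (rule greene_equiv_append[OF greene_equiv_sym[OF greene_equiv_kappa1_single]]) (use assms(2) in auto)
    also have "\<dots> = (?B @ ?A) @ [(b, d), (a, d)] @ z" by simp
    also have "\<dots> \<approx>\<^sub>G (?B @ ?A) @ ((b, d) # z @ [(a, d)])"
      by (rule greene_equiv_appendL[OF greene_equiv_kappa2_thin]) (use assms(2) d Suc.prems in auto)
    also have "\<dots> = ([(b, real N * d), (a, real N * d)] @ ((b, d) # z)) @ [(a, d)]" by simp
    also have "\<dots> \<approx>\<^sub>G ((b, real N * d) # ((b, d) # z) @ [(a, real N * d)]) @ [(a, d)]"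
      by (rule greene_equiv_appendR[OF Suc.IH]) (use Suc.prems d in auto)
    also have "\<dots> = [(b, real N * d), (b, d)] @ (z @ [(a, real N * d), (a, d)])" by simp
    also have "\<dots> \<approx>\<^sub>G [(b, real (Suc N) * d)] @ (z @ [(a, real N * d), (a, d)])"
      by (rule greene_equiv_appendR[OF greene_equiv_sym[OF greene_equiv_split_mult(2)]]) (use d in simp)
    also have "\<dots> = ([(b, real (Suc N) * d)] @ z) @ [(a, real N * d), (a, d)]" by simp
    also have "\<dots> \<approx>\<^sub>G ([(b, real (Suc N) * d)] @ z) @ [(a, real (Suc N) * d)]"
      by (rule greene_equiv_appendL[OF greene_equiv_sym[OF greene_equiv_split_mult(2)]]) (use d in simp)
    finally show ?case by simp
  qed
  with d(2) show ?thesis by simp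
qed

text \<open>
  Two words of equal length have a common refinement: it suffices to treat the empty words, to
  add pieces of equal length in front, and to cut first pieces.
\<close>

lemma equal_length_induct [consumes 3, case_names Nil Cons split_left split_right]:
  assumes "\<forall>p\<in>set y. 0 < snd p" "\<forall>p\<in>set z. 0 < snd p" "tlen y = tlen z"
    and "P [] []"
    and "\<And>b c m y z. 0 < m \<Longrightarrow> \<forall>p\<in>set y. 0 < snd p \<Longrightarrow> \<forall>p\<in>set z. 0 < snd p \<Longrightarrow>
          P y z \<Longrightarrow> P ((b, m) # y) ((c, m) # z)"
    and "\<And>b s t y z. 0 < s \<Longrightarrow> 0 < t \<Longrightarrow> P ((b, s) # (b, t) # y) z \<Longrightarrow> P ((b, s + t) # y) z"
    and "\<And>c s t y z. 0 < s \<Longrightarrow> 0 < t \<Longrightarrow> P y ((c, s) # (c, t) # z) \<Longrightarrow> P y ((c, s + t) # z)"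
  shows "P y z"
  using assms(1-3)
proof (induction "length y + length z" arbitrary: y z rule: less_induct)
  case less
  have nn: "0 \<le> tlen w" if "\<forall>p\<in>set w. 0 < snd p" for w
    by (rule tlen_nonneg) (use that in \<open>auto simp: nonneg_def less_imp_le\<close>)
  show ?case
  proof (cases "y = [] \<or> z = []")
    case True
    have "y = []" "z = []"
      using True less.prems nn by (cases y; cases z; fastforce)+
    then show ?thesis using assms(4) by simp
  next
    case False
    then obtain b s y' c t z' where yz: "y = (b, s) # y'" "z = (c, t) # z'"
      by (metis neq_Nil_conv surj_pair)
    then have pos: "0 < s" "0 < t" "\<forall>p\<in>set y'. 0 < snd p" "\<forall>p\<in>set z'. 0 < snd p"
      and len: "s + tlen y' = t + tlen z'" using less.prems by auto
    consider "s = t" | "s < t" | "t < s" by linarith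
    then show ?thesis
    proof cases
      case 1
      then show ?thesis using less.hyps[of y' z'] assms(5) yz pos len by simp
    next
      case 2
      have "P y' ((c, t - s) # z')" by (rule less.hyps) (use 2 yz pos len in auto)
      \<comment> \<open>The first piece of \<open>z\<close> is cut so that its first part matches that of \<open>y\<close>.\<close>
      then have "P y ((c, s) # (c, t - s) # z')" unfolding yz using pos 2 by (intro assms(5)) auto
      then show ?thesis using assms(7)[of s "t - s" y c z'] 2 pos yz by simp
    next
      case 3
      have "P ((b, s - t) # y') z'" by (rule less.hyps) (use 3 yz pos len in auto)
      then have "P ((b, t) # (b, s - t) # y') z" unfolding yz using pos 3 by (intro assms(5)) auto
      then show ?thesis using assms(6)[of t "s - t" b y' z] 3 pos yz by simp
    qed
  qed
qed

text \<open>
  If \<open>y\<close> and \<open>z\<close> begin with \<open>b\<^sup>m\<close> and \<open>c\<^sup>m\<close>, the second relation brings \<open>b\<^sup>m\<close> next to \<open>c\<^sup>m\<close>. Then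
  \<open>c\<^sup>m\<close> passes \<open>x\<close>, and the remaining parts of \<open>y\<close> and \<open>z\<close> are treated with \<open>x b\<^sup>m\<close> in place of
  \<open>x\<close>.
\<close>

lemma greene_equiv_kappa1:
  assumes "\<forall>p\<in>set (x @ y @ z). 0 < snd p" "tlen y = tlen z"
    and "sorted (map fst (x @ y @ z))" "\<forall>p\<in>set y. \<forall>q\<in>set z. fst p < fst q"
  shows "x @ z @ y \<approx>\<^sub>G z @ x @ y"
proof -
  have "\<forall>p\<in>set y. 0 < snd p" "\<forall>p\<in>set z. 0 < snd p" using assms(1) by auto
  then show ?thesis using assms(2,1,3,4)
  proof (induction y z arbitrary: x rule: equal_length_induct)
    case (Cons b c m y z)
    have 1: "[(c, m), (b, m)] @ z \<approx>\<^sub>G (c, m) # z @ [(b, m)]"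
      by (rule greene_equiv_kappa2_one) (use Cons.prems Cons.hyps in \<open>auto simp: sorted_append\<close>)
    have 2: "x @ [(c, m), (b, m)] \<approx>\<^sub>G (c, m) # x @ [(b, m)]"
      by (rule greene_equiv_kappa1_one) (use Cons.prems Cons.hyps in \<open>auto simp: sorted_append\<close>)
    have "x @ ((c, m) # z) @ (b, m) # y = x @ ((c, m) # z @ [(b, m)]) @ y" by simp
    also have "\<dots> \<approx>\<^sub>G x @ ([(c, m), (b, m)] @ z) @ y"
      by (rule greene_equiv_append[OF greene_equiv_sym[OF 1]])
    also have "\<dots> = (x @ [(c, m), (b, m)]) @ z @ y" by simp
    also have "\<dots> \<approx>\<^sub>G ((c, m) # x @ [(b, m)]) @ z @ y" by (rule greene_equiv_appendR[OF 2])
    also have "\<dots> = [(c, m)] @ ((x @ [(b, m)]) @ z @ y)" by simp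
    also have "\<dots> \<approx>\<^sub>G [(c, m)] @ (z @ (x @ [(b, m)]) @ y)"
      by (rule greene_equiv_appendL[OF Cons.IH]) (use Cons.prems in \<open>auto simp: sorted_append\<close>)
    finally show ?case by simp
  next
    case (split_left b s t y z)
    have sp: "[(b, s + t)] \<approx>\<^sub>G [(b, s), (b, t)]" using split_left by (intro greene_equiv_split) auto
    have "x @ z @ (b, s + t) # y \<approx>\<^sub>G x @ z @ (b, s) # (b, t) # y"
      using greene_equiv_append[OF sp, of "x @ z" y] by simp
    also have "\<dots> \<approx>\<^sub>G z @ x @ (b, s) # (b, t) # y"
      by (rule split_left.IH) (use split_left in \<open>auto simp: sorted_append\<close>)
    also have "\<dots> \<approx>\<^sub>G z @ x @ (b, s + t) # y"
      using greene_equiv_append[OF greene_equiv_sym[OF sp], of "z @ x" y] by simp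
    finally show ?case .
  next
    case (split_right c s t y z)
    have sp: "[(c, s + t)] \<approx>\<^sub>G [(c, s), (c, t)]" using split_right by (intro greene_equiv_split) auto
    have "x @ ((c, s + t) # z) @ y \<approx>\<^sub>G x @ ((c, s) # (c, t) # z) @ y"
      using greene_equiv_append[OF sp, of x "z @ y"] by simp
    also have "\<dots> \<approx>\<^sub>G ((c, s) # (c, t) # z) @ x @ y"
      by (rule split_right.IH) (use split_right in \<open>auto simp: sorted_append\<close>)
    also have "\<dots> \<approx>\<^sub>G ((c, s + t) # z) @ x @ y"
      using greene_equiv_append[OF greene_equiv_sym[OF sp], of "[]" "z @ x @ y"] by simp
    finally show ?case .
  qed simp
qed

lemma greene_equiv_kappa2:
  assumes "\<forall>p\<in>set (x @ y @ z). 0 < snd p" "tlen x = tlen y"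
    and "sorted (map fst (x @ y @ z))" "\<forall>p\<in>set x. \<forall>q\<in>set y. fst p < fst q"
  shows "y @ x @ z \<approx>\<^sub>G y @ z @ x"
proof -
  have "\<forall>p\<in>set x. 0 < snd p" "\<forall>p\<in>set y. 0 < snd p" using assms(1) by auto
  then show ?thesis using assms(2,1,3,4)
  proof (induction x y arbitrary: z rule: equal_length_induct)
    case (Cons a b m x y)
    have 1: "[(b, m), (a, m)] @ w \<approx>\<^sub>G (b, m) # w @ [(a, m)]"
      if "\<forall>p\<in>set w. p \<in> set y \<union> set z" "sorted (map fst w)" for w
    proof (rule greene_equiv_kappa2_one)
      show "\<forall>p\<in>set w. b \<le> fst p \<and> 0 < snd p"
        using Cons.prems that(1) by (auto simp: sorted_append ball_Un)
    qed (use Cons.prems Cons.hyps that in auto)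
    have "((b, m) # y) @ ((a, m) # x) @ z = ((b, m) # y @ [(a, m)]) @ (x @ z)" by simp
    also have "\<dots> \<approx>\<^sub>G ([(b, m), (a, m)] @ y) @ (x @ z)"
      by (rule greene_equiv_appendR[OF greene_equiv_sym[OF 1]])
        (use Cons.prems in \<open>auto simp: sorted_append\<close>)
    also have "\<dots> = [(b, m), (a, m)] @ (y @ x @ z)" by simp
    also have "\<dots> \<approx>\<^sub>G [(b, m), (a, m)] @ (y @ z @ x)"
      by (rule greene_equiv_appendL[OF Cons.IH]) (use Cons.prems in \<open>auto simp: sorted_append\<close>)
    also have "\<dots> = ([(b, m), (a, m)] @ (y @ z)) @ x" by simp
    also have "\<dots> \<approx>\<^sub>G ((b, m) # (y @ z) @ [(a, m)]) @ x"
      by (rule greene_equiv_appendR[OF 1]) (use Cons.prems in \<open>auto simp: sorted_append\<close>)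
    finally show ?case by simp
  next
    case (split_left a s t x y)
    have sp: "[(a, s + t)] \<approx>\<^sub>G [(a, s), (a, t)]" using split_left by (intro greene_equiv_split) auto
    have "y @ ((a, s + t) # x) @ z \<approx>\<^sub>G y @ ((a, s) # (a, t) # x) @ z"
      using greene_equiv_append[OF sp, of y "x @ z"] by simp
    also have "\<dots> \<approx>\<^sub>G y @ z @ ((a, s) # (a, t) # x)"
      by (rule split_left.IH) (use split_left in \<open>auto simp: sorted_append\<close>)
    also have "\<dots> \<approx>\<^sub>G y @ z @ ((a, s + t) # x)"
      using greene_equiv_append[OF greene_equiv_sym[OF sp], of "y @ z" x] by simp
    finally show ?case .
  next
    case (split_right b s t x y)
    have sp: "[(b, s + t)] \<approx>\<^sub>G [(b, s), (b, t)]" using split_right by (intro greene_equiv_split) auto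
    have "((b, s + t) # y) @ x @ z \<approx>\<^sub>G ((b, s) # (b, t) # y) @ x @ z"
      using greene_equiv_append[OF sp, of "[]" "y @ x @ z"] by simp
    also have "\<dots> \<approx>\<^sub>G ((b, s) # (b, t) # y) @ z @ x"
      by (rule split_right.IH) (use split_right in \<open>auto simp: sorted_append\<close>)
    also have "\<dots> \<approx>\<^sub>G ((b, s + t) # y) @ z @ x"
      using greene_equiv_append[OF greene_equiv_sym[OF sp], of "[]" "y @ z @ x"] by simp
    finally show ?case .
  qed simp
qed

section \<open>Knuth equivalence as a congruence\<close>

lemma tfun_last_piece:
  assumes "\<forall>p\<in>set y. 0 < snd p" "0 < t" "tlen y \<le> x" "x < tlen y + t"
  shows "tfun (y @ [(b, t)]) x = b"
  using assms
proof (induction y arbitrary: x)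
  case (Cons p y)
  have "0 \<le> tlen y" using Cons.prems(1) by (intro tlen_nonneg) (auto simp: nonneg_def less_imp_le)
  then show ?case using Cons by (cases p) (auto simp: algebra_simps)
qed simp

lemma Lim_at_left_tfun:
  assumes "\<forall>p\<in>set y. 0 < snd p" "y \<noteq> []"
  shows "Lim (at_left (tlen y)) (tfun y) = fst (last y)"
proof -
  obtain u b t where y: "y = u @ [(b, t)]"
    using assms(2) by (metis rev_exhaust surj_pair)
  have t: "0 < t" using assms(1) y by simp
  have "\<forall>\<^sub>F x in at_left (tlen y). x \<in> {tlen u<..<tlen y}"
    by (rule eventually_at_leftI[of "tlen u"]) (use y t in auto)
  then have "\<forall>\<^sub>F x in at_left (tlen y). tfun y x = b"
    by eventually_elim (use tfun_last_piece[of u t] assms(1) y t in auto)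
  then have "(tfun y \<longlongrightarrow> b) (at_left (tlen y))"
    by (rule tendsto_eventually)
  then show ?thesis using y by (simp add: tendsto_Lim)
qed

lemma tfun_0: "\<forall>p\<in>set z. 0 < snd p \<Longrightarrow> z \<noteq> [] \<Longrightarrow> tfun z 0 = fst (hd z)"
  by (cases z) auto

lemma twords_pos: "w \<in> twords n \<Longrightarrow> \<forall>p\<in>set w. 0 < snd p"
  by (simp add: twords_def is_tword_iff)

lemma twords_nonneg: "w \<in> twords n \<Longrightarrow> nonneg w"
  using twords_pos by (fastforce simp: nonneg_def)

lemma tconc3: "u \<cdot>\<^sub>t v \<cdot>\<^sub>t w = merge (u @ v @ w)"
  by (simp add: tconc_def)

lemma sorted_letters_less:
  assumes "sorted (map fst (y @ z))" "y \<noteq> []" "z \<noteq> []" "fst (last y) < fst (hd z)"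
  shows "\<forall>p\<in>set y. \<forall>q\<in>set z. fst p < fst q"
proof -
  obtain y' l where y: "y = y' @ [l]" using assms(2) by (metis rev_exhaust)
  obtain h z' where z: "z = h # z'" using assms(3) by (cases z) auto
  show ?thesis using assms(1,4) unfolding y z by (fastforce simp: sorted_append)
qed

lemma knuth_rel_greene_equiv: "knuth_rel n s s' \<Longrightarrow> s \<approx>\<^sub>G s'"
proof (induction rule: knuth_rel.induct)
  case (kappa1 x y z)
  note pos = kappa1(1-3)[THEN twords_pos]
  have nn: "nonneg (x @ z @ y)" "nonneg (z @ x @ y)" using kappa1(1-3)[THEN twords_nonneg] by auto
  have sorted: "sorted (map fst (x @ y @ z))"
    using kappa1(6) by (simp add: timed_row_def tconc3 sorted_wrt_less_merge)
  have "\<forall>p\<in>set y. \<forall>q\<in>set z. fst p < fst q"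
    using kappa1(4,5,8) sorted pos
    by (intro sorted_letters_less) (auto simp: Lim_at_left_tfun tfun_0 sorted_append)
  then have "x @ z @ y \<approx>\<^sub>G z @ x @ y"
    using pos kappa1(7) sorted by (intro greene_equiv_kappa1) auto
  then show ?case unfolding tconc3
    using greene_equiv_merge[OF nn(1)] greene_equiv_merge[OF nn(2)] by (metis greene_equiv_sym greene_equiv_trans)
next
  case (kappa2 x y z)
  note pos = kappa2(1-3)[THEN twords_pos]
  have nn: "nonneg (y @ x @ z)" "nonneg (y @ z @ x)" using kappa2(1-3)[THEN twords_nonneg] by auto
  have sorted: "sorted (map fst (x @ y @ z))"
    using kappa2(6) by (simp add: timed_row_def tconc3 sorted_wrt_less_merge)
  have "\<forall>p\<in>set x. \<forall>q\<in>set y. fst p < fst q"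
    using kappa2(4,5,8) sorted pos
    by (intro sorted_letters_less) (auto simp: Lim_at_left_tfun tfun_0 sorted_append)
  then have "y @ x @ z \<approx>\<^sub>G y @ z @ x"
    using pos kappa2(7) sorted by (intro greene_equiv_kappa2) auto
  then show ?case unfolding tconc3
    using greene_equiv_merge[OF nn(1)] greene_equiv_merge[OF nn(2)] by (metis greene_equiv_sym greene_equiv_trans)
qed

lemma tconc_in_twords: "u \<in> twords n \<Longrightarrow> v \<in> twords n \<Longrightarrow> u \<cdot>\<^sub>t v \<in> twords n"
  unfolding twords_def tconc_def is_tword_iff mem_Collect_eq fst_set_merge
  by (intro conjI set_merge_pos distinct_adj_merge) auto

lemma knuth_rel_twords: "knuth_rel n s s' \<Longrightarrow> s \<in> twords n \<and> s' \<in> twords n"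
  by (induction rule: knuth_rel.induct) (simp_all add: tconc_in_twords)

lemma knuth_move_greene_equiv:
  assumes "knuth_move n w w'" shows "w \<approx>\<^sub>G w'"
proof -
  from assms obtain p q s s' where pq: "p \<in> twords n" "q \<in> twords n"
    and s: "knuth_rel n s s' \<or> knuth_rel n s' s" and w: "w = p \<cdot>\<^sub>t s \<cdot>\<^sub>t q" "w' = p \<cdot>\<^sub>t s' \<cdot>\<^sub>t q"
    unfolding knuth_move_def by blast
  have "s \<approx>\<^sub>G s'" using s knuth_rel_greene_equiv greene_equiv_sym by blast
  then have "p @ s @ q \<approx>\<^sub>G p @ s' @ q" by (rule greene_equiv_append)
  moreover have "nonneg (p @ s @ q)" "nonneg (p @ s' @ q)"
    using pq knuth_rel_twords[of n s s'] knuth_rel_twords[of n s' s] s by (auto intro: twords_nonneg)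
  ultimately show ?thesis unfolding w tconc3
    using greene_equiv_merge[of "p @ s @ q"] greene_equiv_merge[of "p @ s' @ q"]
    by (meson greene_equiv_sym greene_equiv_trans)
qed

lemma knuth_equiv_greene_equiv: "knuth_equiv n w w' \<Longrightarrow> w \<approx>\<^sub>G w'"
  unfolding knuth_equiv_def
  by (induction rule: rtranclp_induct) (auto dest: knuth_move_greene_equiv intro: greene_equiv_trans)

lemma knuth_equiv_refl [simp]: "knuth_equiv n w w"
  by (simp add: knuth_equiv_def)

lemma knuth_equiv_trans [trans]:
  "knuth_equiv n u v \<Longrightarrow> knuth_equiv n v w \<Longrightarrow> knuth_equiv n u w"
  unfolding knuth_equiv_def by (rule rtranclp_trans)

lemma knuth_equiv_sym: "knuth_equiv n u v \<Longrightarrow> knuth_equiv n v u"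
proof -
  have "symp (knuth_move n)"
  proof (rule sympI)
    fix w w' assume "knuth_move n w w'"
    then obtain p q s s' where "p \<in> twords n" "q \<in> twords n"
      "knuth_rel n s' s \<or> knuth_rel n s s'" "w' = p \<cdot>\<^sub>t s' \<cdot>\<^sub>t q" "w = p \<cdot>\<^sub>t s \<cdot>\<^sub>t q"
      unfolding knuth_move_def by blast
    then show "knuth_move n w' w" unfolding knuth_move_def
      by (intro bexI[of _ p] bexI[of _ q] exI[of _ s'] exI[of _ s]) simp_all
  qed
  from sympD[OF symp_rtranclp[OF this]]
  show "knuth_equiv n u v \<Longrightarrow> knuth_equiv n v u" unfolding knuth_equiv_def .
qed

lemma knuth_equiv_tconc:
  assumes "knuth_equiv n s s'" "p \<in> twords n" "q \<in> twords n"
  shows "knuth_equiv n (p \<cdot>\<^sub>t s \<cdot>\<^sub>t q) (p \<cdot>\<^sub>t s' \<cdot>\<^sub>t q)"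
  using assms(1) unfolding knuth_equiv_def
proof (induction rule: rtranclp_induct)
  case (step y z)
  then obtain a b t t' where m: "a \<in> twords n" "b \<in> twords n" "knuth_rel n t t' \<or> knuth_rel n t' t"
    "y = a \<cdot>\<^sub>t t \<cdot>\<^sub>t b" "z = a \<cdot>\<^sub>t t' \<cdot>\<^sub>t b"
    unfolding knuth_move_def by blast
  have "p \<cdot>\<^sub>t y \<cdot>\<^sub>t q = (p \<cdot>\<^sub>t a) \<cdot>\<^sub>t t \<cdot>\<^sub>t (b \<cdot>\<^sub>t q)" "p \<cdot>\<^sub>t z \<cdot>\<^sub>t q = (p \<cdot>\<^sub>t a) \<cdot>\<^sub>t t' \<cdot>\<^sub>t (b \<cdot>\<^sub>t q)"
    unfolding m by (simp_all add: tconc_def)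
  then have "knuth_move n (p \<cdot>\<^sub>t y \<cdot>\<^sub>t q) (p \<cdot>\<^sub>t z \<cdot>\<^sub>t q)"
    unfolding knuth_move_def using m assms(2,3)
    by (intro bexI[of _ "p \<cdot>\<^sub>t a"] bexI[of _ "b \<cdot>\<^sub>t q"] exI[of _ t] exI[of _ t'] conjI)
      (simp_all add: tconc_in_twords)
  then show ?case using step.IH by simp
qed simp

text \<open>
  All pieces have nonnegative length and letters between \<open>l\<close> and \<open>n\<close>.
\<close>

definition letters_in :: "nat \<Rightarrow> nat \<Rightarrow> tword \<Rightarrow> bool" where
  "letters_in l n w \<longleftrightarrow> nonneg w \<and> fst ` set w \<subseteq> {l..n}"

lemma letters_in_simps [simp]: "letters_in l n []"
  "letters_in l n (p # w) \<longleftrightarrow> 0 \<le> snd p \<and> l \<le> fst p \<and> fst p \<le> n \<and> letters_in l n w"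
  "letters_in l n (u @ v) \<longleftrightarrow> letters_in l n u \<and> letters_in l n v"
  by (auto simp: letters_in_def)

lemma letters_in_nonneg: "letters_in l n w \<Longrightarrow> nonneg w"
  by (simp add: letters_in_def)

lemma letters_in_mono: "letters_in l n w \<Longrightarrow> l' \<le> l \<Longrightarrow> letters_in l' n w"
  by (auto simp: letters_in_def)

lemma letters_in_norm: "letters_in (Suc 0) n w \<Longrightarrow> norm_word w \<in> twords n"
  by (intro norm_in_twords) (simp add: letters_in_def)

text \<open>
  Knuth equivalence of the timed words represented by two sequences.
\<close>

definition knuth_eq :: "nat \<Rightarrow> tword \<Rightarrow> tword \<Rightarrow> bool" where
  "knuth_eq n w w' \<longleftrightarrow> knuth_equiv n (norm_word w) (norm_word w')"

lemma knuth_eq_refl [simp]: "knuth_eq n w w"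
  by (simp add: knuth_eq_def)

lemma knuth_eq_sym: "knuth_eq n w w' \<Longrightarrow> knuth_eq n w' w"
  by (simp add: knuth_eq_def knuth_equiv_sym)

lemma knuth_eq_trans [trans]: "knuth_eq n u v \<Longrightarrow> knuth_eq n v w \<Longrightarrow> knuth_eq n u w"
  unfolding knuth_eq_def by (rule knuth_equiv_trans)

lemma knuth_eq_norm: "norm_word w = norm_word w' \<Longrightarrow> knuth_eq n w w'"
  by (simp add: knuth_eq_def)

lemma knuth_eq_append:
  "knuth_eq n s s' \<Longrightarrow> letters_in (Suc 0) n p \<Longrightarrow> letters_in (Suc 0) n q \<Longrightarrow> knuth_eq n (p @ s @ q) (p @ s' @ q)"
  unfolding knuth_eq_def norm_append3 by (intro knuth_equiv_tconc letters_in_norm)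

lemma knuth_eq_greene_equiv:
  "knuth_eq n w w' \<Longrightarrow> nonneg w \<Longrightarrow> nonneg w' \<Longrightarrow> w \<approx>\<^sub>G w'"
  unfolding knuth_eq_def
  by (meson greene_equiv_norm greene_equiv_sym greene_equiv_trans knuth_equiv_greene_equiv)

lemma norm_word_empty_iff: "nonneg w \<Longrightarrow> norm_word w = [] \<longleftrightarrow> tlen w = 0"
proof -
  assume w: "nonneg w"
  have "v = [] \<longleftrightarrow> tlen v = 0" if "is_tword v" for v
  proof (cases v)
    case (Cons p u)
    then have "nonneg u" "0 < snd p" using that by (auto simp: is_tword_iff nonneg_def less_imp_le)
    then show ?thesis using Cons tlen_nonneg[of u] by auto
  qed simp
  from this[OF is_tword_norm] w show ?thesis by simp
qed

lemma norm_pos: "\<forall>p\<in>set (norm_word w). 0 < snd p"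
  using is_tword_norm by (simp add: is_tword_iff)

lemma Lim_norm_less:
  assumes "\<forall>p\<in>set y. \<forall>q\<in>set z. fst p < fst q" "norm_word y \<noteq> []" "norm_word z \<noteq> []"
  shows "Lim (at_left (tlen (norm_word y))) (tfun (norm_word y)) < tfun (norm_word z) 0"
proof -
  have "fst (last (norm_word y)) \<in> fst ` set y" "fst (hd (norm_word z)) \<in> fst ` set z"
    using fst_set_norm[of y] fst_set_norm[of z] assms(2,3) by (meson imageI last_in_set hd_in_set subsetD)+
  then have "fst (last (norm_word y)) < fst (hd (norm_word z))" using assms(1) by fastforce
  with assms show ?thesis by (simp add: Lim_at_left_tfun tfun_0 norm_pos)
qed

lemma timed_row_norm3:
  "sorted (map fst (x @ y @ z)) \<Longrightarrow> timed_row (norm_word x \<cdot>\<^sub>t norm_word y \<cdot>\<^sub>t norm_word z)"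
  unfolding norm_append3[symmetric] timed_row_norm by (rule sorted_filter)

lemma knuth_eq_kappa1:
  assumes "letters_in (Suc 0) n (x @ y @ z)" "tlen y = tlen z" "sorted (map fst (x @ y @ z))"
    "\<forall>p\<in>set y. \<forall>q\<in>set z. fst p < fst q"
  shows "knuth_eq n (x @ z @ y) (z @ x @ y)"
proof -
  have nn: "nonneg x" "nonneg y" "nonneg z" using assms(1) by (auto intro: letters_in_nonneg)
  show ?thesis
proof (cases "norm_word y = []")
  case True
  then have "norm_word z = []" using nn assms(2) by (simp add: norm_word_empty_iff)
  then show ?thesis using True by (simp add: knuth_eq_def norm_append tconc_def)
next
  case False
  then have "norm_word z \<noteq> []" using nn assms(2) by (simp add: norm_word_empty_iff)
  with False assms have "knuth_rel n (norm_word x \<cdot>\<^sub>t norm_word z \<cdot>\<^sub>t norm_word y)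
      (norm_word z \<cdot>\<^sub>t norm_word x \<cdot>\<^sub>t norm_word y)"
    by (intro knuth_rel.kappa1 timed_row_norm3 Lim_norm_less)
      (use nn in \<open>auto simp: letters_in_norm\<close>)
  then have "knuth_move n ([] \<cdot>\<^sub>t norm_word (x @ z @ y) \<cdot>\<^sub>t []) ([] \<cdot>\<^sub>t norm_word (z @ x @ y) \<cdot>\<^sub>t [])"
    unfolding knuth_move_def norm_append3
    by (intro bexI[of _ "[]"] exI conjI) (auto simp: twords_def is_tword_def)
  then show ?thesis by (simp add: knuth_eq_def knuth_equiv_def tconc_def norm_word_def)
qed
qed

lemma knuth_eq_kappa2:
  assumes "letters_in (Suc 0) n (x @ y @ z)" "tlen x = tlen y" "sorted (map fst (x @ y @ z))"
    "\<forall>p\<in>set x. \<forall>q\<in>set y. fst p < fst q"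
  shows "knuth_eq n (y @ x @ z) (y @ z @ x)"
proof -
  have nn: "nonneg x" "nonneg y" "nonneg z" using assms(1) by (auto intro: letters_in_nonneg)
  show ?thesis
proof (cases "norm_word x = []")
  case True
  then show ?thesis by (simp add: knuth_eq_def norm_append tconc_def)
next
  case False
  then have "norm_word y \<noteq> []" using nn assms(2) by (simp add: norm_word_empty_iff)
  with False assms have "knuth_rel n (norm_word y \<cdot>\<^sub>t norm_word x \<cdot>\<^sub>t norm_word z)
      (norm_word y \<cdot>\<^sub>t norm_word z \<cdot>\<^sub>t norm_word x)"
    by (intro knuth_rel.kappa2 timed_row_norm3 Lim_norm_less)
      (use nn in \<open>auto simp: letters_in_norm\<close>)
  then have "knuth_move n ([] \<cdot>\<^sub>t norm_word (y @ x @ z) \<cdot>\<^sub>t []) ([] \<cdot>\<^sub>t norm_word (y @ z @ x) \<cdot>\<^sub>t [])"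
    unfolding knuth_move_def norm_append3
    by (intro bexI[of _ "[]"] exI conjI) (auto simp: twords_def is_tword_def)
  then show ?thesis by (simp add: knuth_eq_def knuth_equiv_def tconc_def norm_word_def)
qed
qed

section \<open>Row insertion and tableaux\<close>

text \<open>
  The initial part of length \<open>t\<close> of a word, and the part that remains.
\<close>

fun take_len :: "real \<Rightarrow> tword \<Rightarrow> tword" where
  "take_len t [] = []"
| "take_len t ((c, s) # w) = (if s \<le> t then (c, s) # take_len (t - s) w else [(c, t)])"

fun drop_len :: "real \<Rightarrow> tword \<Rightarrow> tword" where
  "drop_len t [] = []"
| "drop_len t ((c, s) # w) = (if s \<le> t then drop_len (t - s) w else (c, s - t) # w)"

lemma letters_in_take_drop:
  "letters_in l n w \<Longrightarrow> 0 \<le> t \<Longrightarrow> letters_in l n (take_len t w) \<and> letters_in l n (drop_len t w)"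
  by (induction t w rule: take_len.induct) auto

lemma fst_take_len: "fst ` set (take_len t w) \<subseteq> fst ` set w"
  by (induction t w rule: take_len.induct) auto

lemma fst_drop_len: "fst ` set (drop_len t w) \<subseteq> fst ` set w"
  by (induction t w rule: drop_len.induct) auto

lemma norm_take_drop:
  "0 \<le> t \<Longrightarrow> nonneg w \<Longrightarrow> norm_word (take_len t w @ drop_len t w) = norm_word w"
proof (induction t w rule: take_len.induct)
  case (2 t c s w)
  show ?case
  proof (cases "s \<le> t")
    case True
    then show ?thesis using 2 norm_append[of "[(c, s)]"] by (simp del: append_Cons add: append_Cons[symmetric])
       (metis append_Cons append_Nil norm_append)
  next
    case False
    then show ?thesis using norm_split[of t "s - t" "[]" c w] 2 by simp
  qed
qed simp

lemma sorted_take_drop: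
  "sorted (map fst w) \<Longrightarrow> sorted (map fst (take_len t w @ drop_len t w))"
proof (induction t w rule: take_len.induct)
  case (2 t c s w)
  have "\<forall>q\<in>set (take_len (t - s) w) \<union> set (drop_len (t - s) w). c \<le> fst q"
    using fst_take_len[of "t - s" w] fst_drop_len[of "t - s" w] 2 by fastforce
  with 2 show ?case by (auto simp: sorted_append)
qed simp

lemma tlen_take_len: "0 \<le> t \<Longrightarrow> t \<le> tlen w \<Longrightarrow> tlen (take_len t w) = t"
  by (induction t w rule: take_len.induct) auto

lemma take_drop_all: "nonneg w \<Longrightarrow> tlen w \<le> t \<Longrightarrow> take_len t w = w \<and> drop_len t w = []"
proof (induction t w rule: take_len.induct)
  case (2 t c s w)
  then show ?case using tlen_nonneg[of w] by auto
qed simp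

text \<open>
  Inserting \<open>c\<^sup>t\<close> into the row \<open>A B\<close>, where \<open>B\<close> consists of the letters greater than \<open>c\<close>, bumps
  the first \<open>t\<close> units of \<open>B\<close> out of the row.
\<close>

lemma knuth_eq_row_insert:
  assumes in1: "letters_in (Suc 0) n (A @ B @ [(c, t)])"
    and sorted: "sorted (map fst (A @ B))" and A: "\<forall>p\<in>set A. fst p \<le> c" and B: "\<forall>p\<in>set B. c < fst p"
  shows "knuth_eq n (A @ B @ [(c, t)]) (take_len t B @ A @ [(c, t)] @ drop_len t B)"
proof (cases "tlen B \<le> t")
  case True
  then have td: "take_len t B = B" "drop_len t B = []"
    using in1 take_drop_all[of B t] True by (auto dest: letters_in_nonneg)
  have B0: "0 \<le> tlen B" using in1 by (auto intro: tlen_nonneg dest: letters_in_nonneg)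
  let ?s = "tlen B"
  have "knuth_eq n (A @ B @ [(c, t)]) ((A @ B @ [(c, ?s)]) @ [(c, t - ?s)])"
    using norm_split[of ?s "t - ?s" "A @ B" c "[]"] True B0 by (intro knuth_eq_norm) simp
  also have "knuth_eq n \<dots> ((B @ A @ [(c, ?s)]) @ [(c, t - ?s)])"
  proof -
    have "knuth_eq n (A @ B @ [(c, ?s)]) (B @ A @ [(c, ?s)])"
      by (rule knuth_eq_kappa1) (use in1 sorted A B B0 in \<open>auto simp: sorted_append less_imp_le\<close>)
    from knuth_eq_append[OF this, of "[]" "[(c, t - ?s)]"] show ?thesis
      using in1 True by simp
  qed
  also have "knuth_eq n \<dots> (B @ A @ [(c, t)])"
    using norm_split[of ?s "t - ?s" "B @ A" c "[]"] True B0 by (intro knuth_eq_norm) simp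
  finally show ?thesis using td by simp
next
  case False
  define B1 B2 where "B1 = take_len t B" and "B2 = drop_len t B"
  have t: "0 \<le> t" using in1 by simp
  have len: "tlen B1 = t" using False t by (simp add: B1_def tlen_take_len)
  have in2: "letters_in (Suc 0) n B1" "letters_in (Suc 0) n B2"
    using in1 t letters_in_take_drop by (auto simp: B1_def B2_def)
  have f: "fst ` set B1 \<subseteq> fst ` set B" "fst ` set B2 \<subseteq> fst ` set B"
    by (simp_all add: B1_def B2_def fst_take_len fst_drop_len)
  have sB: "sorted (map fst (B1 @ B2))" using sorted sorted_take_drop[of B t]
    by (simp add: B1_def B2_def sorted_append)
  have B12: "\<forall>p\<in>set B1. c < fst p" "\<forall>p\<in>set B2. c < fst p" using f B by fastforce+
  have AB: "\<forall>p\<in>set A. \<forall>q\<in>set B1. fst p \<le> fst q"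
    using A B12 by fastforce
  have "knuth_eq n (A @ B @ [(c, t)]) (A @ (B1 @ B2) @ [(c, t)])"
    unfolding B1_def B2_def norm_append3
    by (rule knuth_eq_norm) (use in1 t in \<open>auto simp: norm_append3 norm_take_drop simp del: append_assoc dest: letters_in_nonneg\<close>)
  also have "knuth_eq n \<dots> (A @ (B1 @ [(c, t)] @ B2))"
  proof -
    have "knuth_eq n (B1 @ [(c, t)] @ B2) (B1 @ B2 @ [(c, t)])"
      by (rule knuth_eq_kappa2) (use in1 in2 len sB B12 in \<open>auto simp: sorted_append less_imp_le\<close>)
    from knuth_eq_append[OF knuth_eq_sym[OF this], of A "[]"] show ?thesis using in1 by simp
  qed
  also have "knuth_eq n \<dots> (B1 @ A @ [(c, t)] @ B2)"
  proof -
    have "knuth_eq n (A @ B1 @ [(c, t)]) (B1 @ A @ [(c, t)])"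
      by (rule knuth_eq_kappa1)
        (use in1 in2 len sB sorted A AB B12 in \<open>auto simp: sorted_append less_imp_le\<close>)
    from knuth_eq_append[OF this, of "[]" B2] show ?thesis using in2 by simp
  qed
  finally show ?thesis by (simp add: B1_def B2_def)
qed

text \<open>
  The total length of the pieces with letters at most \<open>k\<close>; in a row these form a prefix.
\<close>

definition prefix_len :: "nat \<Rightarrow> tword \<Rightarrow> real" where
  "prefix_len k w = sum_list (map snd (filter (\<lambda>p. fst p \<le> k) w))"

lemma prefix_len_simps [simp]: "prefix_len k [] = 0"
  "prefix_len k (p # w) = (if fst p \<le> k then snd p else 0) + prefix_len k w"
  "prefix_len k (u @ v) = prefix_len k u + prefix_len k v"
  by (simp_all add: prefix_len_def)

lemma prefix_len_all: "\<forall>p\<in>set w. fst p \<le> k \<Longrightarrow> prefix_len k w = tlen w"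
  by (induction w) auto

lemma prefix_len_none: "\<forall>p\<in>set w. k < fst p \<Longrightarrow> prefix_len k w = 0"
  by (induction w) auto

lemma prefix_len_nonneg: "nonneg w \<Longrightarrow> 0 \<le> prefix_len k w"
  by (induction w) auto

lemma prefix_len_drop_len:
  "sorted (map fst w) \<Longrightarrow> nonneg w \<Longrightarrow> 0 \<le> t \<Longrightarrow>
    prefix_len k (drop_len t w) = max 0 (prefix_len k w - t)"
proof (induction t w rule: drop_len.induct)
  case (2 t c s w)
  show ?case
  proof (cases "c \<le> k")
    case True
    then show ?thesis using 2 prefix_len_nonneg[of w k] by (auto simp: max_def)
  next
    case False
    then have w: "\<forall>p\<in>set w. k < fst p" using 2(2) by fastforce
    moreover have "\<forall>p\<in>set (drop_len (t - s) w). k < fst p"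
      using w fst_drop_len[of "t - s" w] by fastforce
    ultimately show ?thesis using 2(4) False by (simp add: prefix_len_none)
  qed
qed simp

lemma sorted_filter_partition:
  "sorted (map fst R) \<Longrightarrow>
    filter (\<lambda>p. fst p \<le> c) R @ filter (\<lambda>p. c < fst p) R = (R :: tword)"
proof (induction R)
  case (Cons p R)
  show ?case
  proof (cases "fst p \<le> c")
    case False
    then have "\<forall>q\<in>set R. c < fst q" using Cons.prems by fastforce
    then have "filter (\<lambda>p. fst p \<le> c) R = []" "filter (\<lambda>p. c < fst p) R = R"
      by (auto simp: filter_empty_conv filter_id_conv)
    then show ?thesis using False by simp
  qed (use Cons in simp)
qed simp

text \<open>
  \<open>longest_row w k\<close> is the maximal length of a row in \<open>w\<close> with letters at most \<open>k\<close>.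
\<close>

definition longest_row :: "tword \<Rightarrow> nat \<Rightarrow> real" where
  "longest_row w = foldl row_step (\<lambda>_. 0) w"

lemma longest_row_snoc: "longest_row (w @ [p]) = row_step (longest_row w) p"
  by (simp add: longest_row_def)

lemma longest_row_cong: "w \<approx>\<^sub>G w' \<Longrightarrow> longest_row w = longest_row w'"
  by (simp add: longest_row_def greene_equiv_def monoI)

text \<open>
  Splitting off the first row \<open>R\<close> of the tableau of \<open>w\<close>. The lengths of its initial segments are
  those of the longest rows of \<open>w\<close>, and the bumped letters \<open>w'\<close> have increased.
\<close>

lemma first_row:
  assumes "letters_in l n w" "1 \<le> l"
  shows "\<exists>w' R. knuth_eq n w (w' @ R) \<and> letters_in (Suc l) n w' \<and> letters_in l n R \<and>
    sorted (map fst R) \<and> (\<forall>k. prefix_len k R = longest_row w k)"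
  using assms(1)
proof (induction w rule: rev_induct)
  case Nil
  show ?case by (intro exI[of _ "[]"]) (simp add: longest_row_def)
next
  case (snoc p w)
  obtain c t where p: "p = (c, t)" by force
  obtain w' R where IH: "knuth_eq n w (w' @ R)" "letters_in (Suc l) n w'" "letters_in l n R"
    "sorted (map fst R)" "\<And>k. prefix_len k R = longest_row w k"
    using snoc by auto
  define A B where "A = filter (\<lambda>p. fst p \<le> c) R" and "B = filter (\<lambda>p. c < fst p) R"
  have R: "R = A @ B" using sorted_filter_partition[OF IH(4), of c] by (simp add: A_def B_def)
  have A: "\<forall>p\<in>set A. fst p \<le> c" and B: "\<forall>p\<in>set B. c < fst p" by (simp_all add: A_def B_def)
  have t: "0 \<le> t" and c: "l \<le> c" "c \<le> n" using snoc.prems p by auto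
  have inAB: "letters_in l n A" "letters_in l n B" using IH(3) R by auto
  let ?T = "take_len t B" and ?D = "drop_len t B"
  have TD: "letters_in l n ?T" "letters_in l n ?D" using letters_in_take_drop inAB(2) t by auto
  have fT: "\<forall>p\<in>set ?T. c < fst p" and fD: "\<forall>p\<in>set ?D. c < fst p"
    using fst_take_len[of t B] fst_drop_len[of t B] B by fastforce+
  have in1: "letters_in (Suc 0) n v" if "letters_in l n v" for v
    by (rule letters_in_mono[OF that]) (use assms(2) in simp)
  have w'1: "letters_in (Suc 0) n w'" using letters_in_mono[OF IH(2)] by simp
  have "knuth_eq n ([] @ w @ [p]) ([] @ (w' @ R) @ [p])"
    by (rule knuth_eq_append[OF IH(1)]) (use p t c assms(2) in auto)
  then have "knuth_eq n (w @ [p]) (w' @ (A @ B @ [(c, t)]) @ [])" using R p by simp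
  also have "knuth_eq n \<dots> (w' @ (?T @ A @ [(c, t)] @ ?D) @ [])"
    by (rule knuth_eq_append[OF knuth_eq_row_insert])
      (use inAB in1 t c assms(2) IH(4) R A B w'1 in auto)
  finally have "knuth_eq n (w @ [p]) ((w' @ ?T) @ A @ [(c, t)] @ ?D)" by simp
  moreover have "letters_in (Suc l) n (w' @ ?T)"
    using IH(2) TD(1) fT c by (fastforce simp: letters_in_def)
  moreover have "letters_in l n (A @ [(c, t)] @ ?D)" using inAB TD t c by simp
  moreover have sB: "sorted (map fst B)" using IH(4) R by (simp add: sorted_append)
  moreover have "sorted (map fst (A @ [(c, t)] @ ?D))"
    using IH(4) A fD sorted_take_drop[OF sB, of t] unfolding R by (fastforce simp: sorted_append)
  moreover have "prefix_len k (A @ [(c, t)] @ ?D) = longest_row (w @ [p]) k" for k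
  proof (cases "k < c")
    case True
    then have "prefix_len k ?D = 0" "prefix_len k B = 0"
      using fD B by (auto intro!: prefix_len_none)
    then show ?thesis using True IH(5)[of k] R p by (simp add: longest_row_snoc row_step_def)
  next
    case False
    then have "prefix_len k A = tlen A" "prefix_len c A = tlen A" using A
      by (auto intro!: prefix_len_all)
    moreover have "prefix_len c B = 0" using B by (rule prefix_len_none)
    moreover have "prefix_len k ?D = max 0 (prefix_len k B - t)"
      using sB inAB t by (intro prefix_len_drop_len) (auto dest: letters_in_nonneg)
    ultimately show ?thesis using False IH(5)[of k] IH(5)[of c] R p
      by (simp add: longest_row_snoc row_step_def max_def)
  qed
  ultimately show ?case by blast
qed

text \<open>
  The total length of the pieces with letter \<open>j\<close>.
\<close>

definition letter_len :: "tword \<Rightarrow> nat \<Rightarrow> real" where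
  "letter_len w j = sum_list (map snd (filter (\<lambda>p. fst p = j) w))"

lemma letter_len_simps [simp]: "letter_len [] j = 0"
  "letter_len (p # w) j = (if fst p = j then snd p else 0) + letter_len w j"
  by (simp_all add: letter_len_def)

lemma letter_len_nonneg: "nonneg w \<Longrightarrow> 0 \<le> letter_len w j"
  by (induction w) auto

lemma letter_len_notin: "j \<notin> fst ` set w \<Longrightarrow> letter_len w j = 0"
  by (induction w) auto

lemma prefix_len_Suc: "prefix_len (Suc k) w = prefix_len k w + letter_len w (Suc k)"
  by (induction w) auto

lemma prefix_len_eq_sum: "letters_in 1 n w \<Longrightarrow> prefix_len k w = (\<Sum>j = 1..k. letter_len w j)"
proof (induction k)
  case 0
  then show ?case by (intro trans[OF prefix_len_none]) (auto simp: letters_in_def)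
qed (simp add: prefix_len_Suc)

lemma foldl_row_step_ge:
  "nonneg R \<Longrightarrow> f k + letter_len R k \<le> foldl row_step f R k"
proof (induction R arbitrary: f)
  case (Cons p R)
  have "f k + letter_len (p # R) k \<le> row_step f p k + letter_len R k"
    using Cons.prems by (auto simp: row_step_def)
  also have "\<dots> \<le> foldl row_step (row_step f p) R k" using Cons by simp
  finally show ?case by simp
qed simp

text \<open>
  The column condition between the first two rows: the longest row of \<open>w'\<close> with letters at most
  \<open>k + 1\<close> can be continued by the letter \<open>k + 1\<close> of \<open>R\<close>, and the result is not longer than the
  corresponding initial segment of \<open>R\<close>.
\<close>

lemma row_domination:
  assumes "w \<approx>\<^sub>G w' @ R" "nonneg R" "\<And>k. prefix_len k R = longest_row w k"
  shows "longest_row w' (Suc k) \<le> prefix_len k R"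
proof -
  have "longest_row w' (Suc k) + letter_len R (Suc k) \<le> longest_row (w' @ R) (Suc k)"
    unfolding longest_row_def foldl_append by (rule foldl_row_step_ge[OF assms(2)])
  also have "\<dots> = prefix_len (Suc k) R" using longest_row_cong[OF assms(1)] assms(3) by simp
  finally show ?thesis by (simp add: prefix_len_Suc)
qed

lemma ex_rows:
  assumes "letters_in l n w" "1 \<le> l" "l \<le> Suc n"
  shows "\<exists>Rs. length Rs = Suc n - l \<and> knuth_eq n w (concat (rev Rs)) \<and>
    (\<forall>R\<in>set Rs. sorted (map fst R) \<and> letters_in l n R) \<and>
    (Rs \<noteq> [] \<longrightarrow> (\<forall>k. prefix_len k (hd Rs) = longest_row w k)) \<and>
    (\<forall>i k. Suc i < length Rs \<longrightarrow> prefix_len (Suc k) (Rs ! Suc i) \<le> prefix_len k (Rs ! i))"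
  using assms(3,1,2)
proof (induction arbitrary: w rule: inc_induct)
  case base
  then have "w = []" by (cases w) auto
  then show ?case by (intro exI[of _ "[]"]) auto
next
  case (step l)
  obtain w' R where R: "knuth_eq n w (w' @ R)" "letters_in (Suc l) n w'" "letters_in l n R"
    "sorted (map fst R)" "\<And>k. prefix_len k R = longest_row w k"
    using first_row[OF step.prems] by blast
  obtain Rs where Rs: "length Rs = Suc n - Suc l" "knuth_eq n w' (concat (rev Rs))"
    "\<forall>R\<in>set Rs. sorted (map fst R) \<and> letters_in (Suc l) n R"
    "Rs \<noteq> [] \<Longrightarrow> (\<forall>k. prefix_len k (hd Rs) = longest_row w' k)"
    "\<And>i k. Suc i < length Rs \<Longrightarrow> prefix_len (Suc k) (Rs ! Suc i) \<le> prefix_len k (Rs ! i)"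
    using step.IH[OF R(2)] by auto
  have "w \<approx>\<^sub>G w' @ R"
    by (rule knuth_eq_greene_equiv[OF R(1)]) (use R step.prems in \<open>auto dest: letters_in_nonneg\<close>)
  then have dom: "longest_row w' (Suc k) \<le> prefix_len k R" for k
    by (rule row_domination) (use R in \<open>auto dest: letters_in_nonneg\<close>)
  show ?case
  proof (intro exI[of _ "R # Rs"] conjI allI impI ballI)
    show "length (R # Rs) = Suc n - l" using Rs(1) step.hyps by simp
    have "knuth_eq n ([] @ w' @ R) ([] @ concat (rev Rs) @ R)"
      by (rule knuth_eq_append[OF Rs(2)]) (use letters_in_mono[OF R(3)] step.prems in auto)
    with R(1) show "knuth_eq n w (concat (rev (R # Rs)))"
      using knuth_eq_trans by simp
    show "sorted (map fst R')" "letters_in l n R'" if "R' \<in> set (R # Rs)" for R'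
      using that R(3,4) Rs(3) letters_in_mono[of "Suc l" n R' l] by auto
    show "prefix_len k (hd (R # Rs)) = longest_row w k" for k using R(5) by simp
    show "prefix_len (Suc k) ((R # Rs) ! Suc i) \<le> prefix_len k ((R # Rs) ! i)"
      if "Suc i < length (R # Rs)" for i k
    proof (cases i)
      case 0
      then have "Rs \<noteq> []" using that by auto
      then show ?thesis using 0 Rs(4) dom[of k] by (simp add: hd_conv_nth)
    next
      case (Suc i')
      then show ?thesis using that Rs(5)[of i' k] by simp
    qed
  qed
qed

text \<open>
  The row in which the letter \<open>j\<close> has length \<open>f j\<close>, for \<open>l \<le> j \<le> k\<close>.
\<close>

definition row_word :: "nat \<Rightarrow> nat \<Rightarrow> (nat \<Rightarrow> real) \<Rightarrow> tword" where
  "row_word l k f = map (\<lambda>j. (j, f j)) [l..<Suc k]"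

lemma norm_zeros: "\<forall>p\<in>set u. snd p = 0 \<Longrightarrow> norm_word (u @ v) = norm_word v"
  by (simp add: norm_word_def)

lemma norm_row_word:
  "sorted (map fst R) \<Longrightarrow> letters_in l n R \<Longrightarrow>
    norm_word R = norm_word (row_word l n (letter_len R))"
proof (induction R arbitrary: l)
  case Nil
  show ?case using norm_zeros[of "row_word l n (letter_len [])" "[]"]
    by (simp add: row_word_def)
next
  case (Cons p R)
  obtain c s where p: "p = (c, s)" by force
  have c: "l \<le> c" "c \<le> n" "0 \<le> s" and in_c: "letters_in c n R"
    using Cons.prems p by (fastforce simp: letters_in_def)+
  have R0: "letter_len R j = 0" if "j < c" for j
    by (rule letter_len_notin) (use in_c that in \<open>auto simp: letters_in_def\<close>)
  have upt: "[l..<Suc n] = [l..<c] @ c # [Suc c..<Suc n]"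
    using c by (metis le_SucI le_imp_less_Suc upt_conv_Cons upt_add_eq_append le_add_diff_inverse)
  have tail: "map (\<lambda>j. (j, letter_len (p # R) j)) [Suc c..<Suc n] =
      map (\<lambda>j. (j, letter_len R j)) [Suc c..<Suc n]" using p by auto
  have c_n: "row_word c n (letter_len R) =
      (c, letter_len R c) # map (\<lambda>j. (j, letter_len R j)) [Suc c..<Suc n]"
    using c by (simp add: row_word_def upt_conv_Cons[of c "Suc n"] del: upt_Suc)
  have "norm_word (row_word l n (letter_len (p # R))) =
      norm_word (map (\<lambda>j. (j, letter_len (p # R) j)) [l..<c] @ (c, s + letter_len R c) #
        map (\<lambda>j. (j, letter_len (p # R) j)) [Suc c..<Suc n])"
    unfolding row_word_def upt using p by simp
  also have "\<dots> = norm_word ((c, s + letter_len R c) #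
      map (\<lambda>j. (j, letter_len (p # R) j)) [Suc c..<Suc n])"
    by (rule norm_zeros) (use p R0 in auto)
  also have "\<dots> = norm_word ([(c, s)] @ row_word c n (letter_len R))"
    unfolding tail c_n
    using norm_split[of s "letter_len R c" "[]" c "map (\<lambda>j. (j, letter_len R j)) [Suc c..<Suc n]"]
      c(3) letter_len_nonneg[OF letters_in_nonneg[OF in_c]] by simp
  also have "\<dots> = norm_word ([(c, s)] @ R)"
    unfolding norm_append using Cons.IH[OF _ in_c] Cons.prems by simp
  finally show ?case by (simp only: p append_Cons append_Nil)
qed

text \<open>
  A tableau is encoded by the lengths \<open>t i j\<close> of the letter \<open>j\<close> in row \<open>i\<close>, with rows numbered
  from \<open>1\<close>. \<open>tableau_word q k t\<close> reads the rows \<open>q, \<dots>, 1\<close>, in this order, restricted to letters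
  at most \<open>k\<close>.
\<close>

definition tableau_word :: "nat \<Rightarrow> nat \<Rightarrow> (nat \<Rightarrow> nat \<Rightarrow> real) \<Rightarrow> tword" where
  "tableau_word q k t = concat (map (\<lambda>i. row_word 1 k (t i)) (rev [1..<Suc q]))"

text \<open>
  The second condition expresses that columns are strictly increasing: in row \<open>i + 1\<close>, the
  letters at most \<open>k + 1\<close> lie below letters at most \<open>k\<close> of row \<open>i\<close>.
\<close>

definition tableau :: "(nat \<Rightarrow> nat \<Rightarrow> real) \<Rightarrow> bool" where
  "tableau t \<longleftrightarrow> (\<forall>i j. 0 \<le> t i j) \<and>
     (\<forall>i\<ge>1. \<forall>k. (\<Sum>j = 1..Suc k. t (Suc i) j) \<le> (\<Sum>j = 1..k. t i j))"

lemma norm_concat_row_words: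
  "\<forall>R\<in>set Rs. sorted (map fst R) \<and> letters_in 1 n R \<Longrightarrow>
    norm_word (concat Rs) = norm_word (concat (map (\<lambda>R. row_word 1 n (letter_len R)) Rs))"
proof (induction Rs)
  case (Cons R Rs)
  then show ?case using norm_row_word[of R 1 n] by (simp add: norm_append)
qed simp

lemma ex_tableau:
  assumes "letters_in 1 n w"
  obtains t where "tableau t" "knuth_eq n w (tableau_word n n t)"
proof -
  obtain Rs where Rs: "length Rs = n" "knuth_eq n w (concat (rev Rs))"
    "\<forall>R\<in>set Rs. sorted (map fst R) \<and> letters_in 1 n R"
    "\<And>i k. Suc i < length Rs \<Longrightarrow> prefix_len (Suc k) (Rs ! Suc i) \<le> prefix_len k (Rs ! i)"
    using ex_rows[OF assms] by auto
  define t where "t i = (if 1 \<le> i \<and> i \<le> n then letter_len (Rs ! (i - 1)) else (\<lambda>_. 0))" for i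
  have nn: "0 \<le> t i j" for i j
  proof (cases "1 \<le> i \<and> i \<le> n")
    case True
    then have "Rs ! (i - 1) \<in> set Rs" using Rs(1) by (intro nth_mem) linarith
    then show ?thesis using Rs(3) True
      by (auto simp: t_def intro!: letter_len_nonneg dest: letters_in_nonneg)
  qed (auto simp: t_def)
  have sum: "(\<Sum>j = 1..k. t i j) = prefix_len k (Rs ! (i - 1))" if "1 \<le> i" "i \<le> n" for i k
  proof -
    have "Rs ! (i - 1) \<in> set Rs" using Rs(1) that by (intro nth_mem) linarith
    then show ?thesis using Rs(3) that prefix_len_eq_sum[of n "Rs ! (i - 1)" k] by (simp add: t_def)
  qed
  have "(\<Sum>j = 1..Suc k. t (Suc i) j) \<le> (\<Sum>j = 1..k. t i j)" if "1 \<le> i" for i k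
  proof (cases "Suc i \<le> n")
    case True
    then have "prefix_len (Suc k) (Rs ! Suc (i - 1)) \<le> prefix_len k (Rs ! (i - 1))"
      using that Rs(1) by (intro Rs(4)) simp
    then show ?thesis using sum[of "Suc i" "Suc k"] sum[of i k] True that by simp
  next
    case False
    then have "(\<Sum>j = 1..Suc k. t (Suc i) j) = 0" by (simp add: t_def)
    then show ?thesis using nn by (simp add: sum_nonneg)
  qed
  then have "tableau t" using nn by (simp add: tableau_def)
  moreover have "map (\<lambda>i. row_word 1 n (t i)) (rev [1..<Suc n]) =
      map (\<lambda>R. row_word 1 n (letter_len R)) (rev Rs)"
    unfolding rev_map[symmetric] rev_is_rev_conv
    by (rule nth_equalityI) (use Rs(1) in \<open>auto simp: t_def nth_append simp del: upt_Suc\<close>)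
  then have "norm_word (concat (rev Rs)) = norm_word (tableau_word n n t)"
    using norm_concat_row_words[of "rev Rs" n] Rs(3) by (simp add: tableau_word_def)
  then have "knuth_eq n w (tableau_word n n t)"
    using Rs(2) by (simp add: knuth_eq_def)
  ultimately show thesis by (rule that)
qed

section \<open>Time samples and chains of pieces\<close>

text \<open>
  The pieces of a word starting at time \<open>p\<close>, with their lengths replaced by the measures of their
  intersections with \<open>S\<close>.
\<close>

fun slices :: "real \<Rightarrow> tword \<Rightarrow> real set \<Rightarrow> tword" where
  "slices p [] S = []"
| "slices p ((c, s) # w) S = (c, measure lborel (S \<inter> {p..<p + s})) # slices (p + s) w S"

lemma nonneg_slices: "nonneg (slices p w S)"
  by (induction p w S rule: slices.induct) auto

lemma slices_cong:
  "nonneg w \<Longrightarrow> S \<inter> {p..} = T \<inter> {p..} \<Longrightarrow> slices p w S = slices p w T"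
proof (induction p w S rule: slices.induct)
  case (2 p c s w S)
  have "{p..<p + s} = {p..} \<inter> {p..<p + s}" "{p + s..} = {p..} \<inter> {p + s..}"
    using 2(2) by auto
  then have "S \<inter> {p..<p + s} = T \<inter> {p..<p + s}" "S \<inter> {p + s..} = T \<inter> {p + s..}"
    using 2(3) by (metis Int_assoc)+
  then show ?case using 2(1,2) by simp
qed simp

lemma emeasure_lborel_Ico_eq: "emeasure lborel {a..<b} = ennreal (if a \<le> b then b - a else 0)"
  by auto

lemma measure_split_interval:
  assumes "S \<in> sets lborel" "a \<le> b" "b \<le> (c::real)"
  shows "measure lborel (S \<inter> {a..<c}) = measure lborel (S \<inter> {a..<b}) + measure lborel (S \<inter> {b..<c})"
proof -
  have fm: "S \<inter> {x..<y} \<in> fmeasurable lborel" for x y :: real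
    by (rule fmeasurableI2[of "{x..<y}"])
      (use assms(1) in \<open>auto simp: fmeasurable_def emeasure_lborel_Ico_eq\<close>)
  have "S \<inter> {a..<c} = (S \<inter> {a..<b}) \<union> (S \<inter> {b..<c})" using assms(2,3) by auto
  also have "measure lborel \<dots> = measure lborel (S \<inter> {a..<b}) + measure lborel (S \<inter> {b..<c})"
    by (rule measure_Un2[THEN trans]) (use fm in \<open>auto intro!: arg_cong[where f = "measure lborel"]\<close>)
  finally show ?thesis .
qed

lemma measure_Int_interval_le:
  assumes "S \<in> sets lborel" "a \<le> (b::real)"
  shows "measure lborel (S \<inter> {a..<b}) \<le> b - a"
proof -
  have "measure lborel (S \<inter> {a..<b}) \<le> measure lborel {a..<b}"
    by (rule measure_mono_fmeasurable) (use assms in \<open>auto simp: fmeasurable_def emeasure_lborel_Ico\<close>)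
  then show ?thesis using assms(2) by simp
qed

lemma tlen_slices:
  "S \<in> sets lborel \<Longrightarrow> nonneg w \<Longrightarrow> tlen (slices p w S) = measure lborel (S \<inter> {p..<p + tlen w})"
proof (induction p w S rule: slices.induct)
  case (2 p c s w S)
  have "0 \<le> tlen w" using 2 by (simp add: tlen_nonneg)
  then show ?case using 2 measure_split_interval[of S p "p + s" "p + s + tlen w"]
    by (simp add: add.assoc)
qed simp

text \<open>
  The hypothesis says that \<open>b\<close> is the last time at which the measure of \<open>S\<close>, counted from \<open>p\<close>, has
  its current value.
\<close>

lemma tfun_slices:
  assumes "S \<in> sets lborel" "nonneg w" "p \<le> b" "b < p + tlen w"
    and "\<And>b'. b < b' \<Longrightarrow> b' \<le> p + tlen w \<Longrightarrow>
      measure lborel (S \<inter> {p..<b}) < measure lborel (S \<inter> {p..<b'})"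
  shows "tfun (slices p w S) (measure lborel (S \<inter> {p..<b})) = tfun w (b - p)"
  using assms
proof (induction p w S rule: slices.induct)
  case (2 p c s w S)
  have s: "0 \<le> s" and w: "0 \<le> tlen w" using 2 by (simp_all add: tlen_nonneg)
  show ?case
  proof (cases "b < p + s")
    case True
    then have "measure lborel (S \<inter> {p..<b}) < measure lborel (S \<inter> {p..<p + s})"
      using 2(6)[of "p + s"] w by simp
    then show ?thesis using True by simp
  next
    case False
    have split: "measure lborel (S \<inter> {p..<x}) =
        measure lborel (S \<inter> {p..<p + s}) + measure lborel (S \<inter> {p + s..<x})" if "p + s \<le> x" for x
      by (rule measure_split_interval) (use 2 s that in auto)
    have "tfun (slices (p + s) w S) (measure lborel (S \<inter> {p + s..<b})) = tfun w (b - (p + s))"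
    proof (rule 2(1))
      show "measure lborel (S \<inter> {p + s..<b}) < measure lborel (S \<inter> {p + s..<b'})"
        if "b < b'" "b' \<le> p + s + tlen w" for b'
        using 2(6)[of b'] that split[of b] split[of b'] False by (simp add: add.assoc)
    qed (use 2 False in auto)
    then show ?thesis using split[of b] False by (simp add: algebra_simps)
  qed
qed simp

text \<open>
  The greatest element in the definition of \<open>sample_pos\<close> exists, since the measure of \<open>S\<close> up to
  time \<open>b\<close> is a continuous function of \<open>b\<close>.
\<close>

lemma sample_pos_greatest:
  assumes "S \<in> sets lborel" "S \<subseteq> {0..<tlen w}" "0 \<le> t" "t < measure lborel S" "nonneg w"
  shows "0 \<le> sample_pos w S t" "sample_pos w S t < tlen w"
    "measure lborel (S \<inter> {0..<sample_pos w S t}) = t"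
    "\<And>b. sample_pos w S t < b \<Longrightarrow> b \<le> tlen w \<Longrightarrow> t < measure lborel (S \<inter> {0..<b})"
proof -
  let ?L = "tlen w"
  define m where "m b = measure lborel (S \<inter> {0..<b})" for b :: real
  have diff: "m a \<le> m b \<and> m b - m a \<le> b - a" if "0 \<le> a" "a \<le> b" for a b
    using measure_split_interval[OF assms(1), of 0 a b] measure_Int_interval_le[OF assms(1), of a b] that
    by (simp add: m_def)
  have m0: "m 0 = 0" by (simp add: m_def)
  have "S \<inter> {0..<?L} = S" using assms(2) by auto
  then have mL: "m ?L = measure lborel S" by (simp add: m_def)
  have L: "0 \<le> ?L" using assms(5) by (rule tlen_nonneg)
  have cont: "continuous_on {0..?L} m"
  proof (rule continuous_onI)
    fix x e :: real assume "x \<in> {0..?L}" "0 < e"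
    then show "\<exists>d>0. \<forall>x'\<in>{0..?L}. dist x' x < d \<longrightarrow> dist (m x') (m x) \<le> e"
    proof (intro exI[of _ e] conjI ballI impI)
      fix x' assume "x' \<in> {0..?L}" "dist x' x < e"
      then show "dist (m x') (m x) \<le> e"
        using diff[of x x'] diff[of x' x] \<open>x \<in> {0..?L}\<close>
        by (cases "x \<le> x'") (auto simp: dist_real_def)
    qed
  qed
  define B where "B = {b \<in> {0..?L}. m b = t}"
  obtain b0 where b0: "b0 \<in> B"
    using IVT'[of m 0 t ?L] assms(3,4) m0 mL L cont by (auto simp: B_def)
  have "closed B" unfolding B_def by (rule continuous_closed_preimage_constant) (use cont in auto)
  moreover have "bounded B" unfolding B_def by (rule bounded_subset[OF bounded_closed_interval[of 0 ?L]]) auto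
  ultimately have "compact B" by (simp add: compact_eq_bounded_closed)
  then obtain b where b: "b \<in> B" "\<And>x. x \<in> B \<Longrightarrow> x \<le> b"
    using compact_attains_sup[of B] b0 by blast
  have bL: "0 \<le> b" "b < ?L" "m b = t" using b(1) assms(4) mL by (auto simp: B_def less_le)
  have "sample_pos w S t = b"
    unfolding sample_pos_def m_def[symmetric]
    by (rule Greatest_equality) (use bL b(2) in \<open>auto simp: B_def\<close>)
  moreover have "t < m b'" if "b < b'" "b' \<le> ?L" for b'
    using diff[of b b'] bL that b(2)[of b'] by (cases "m b' = t") (auto simp: B_def)
  ultimately show "0 \<le> sample_pos w S t" "sample_pos w S t < ?L"
    "measure lborel (S \<inter> {0..<sample_pos w S t}) = t"
    "\<And>b. sample_pos w S t < b \<Longrightarrow> b \<le> tlen w \<Longrightarrow> t < measure lborel (S \<inter> {0..<b})"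
    using bL by (auto simp: m_def)
qed

text \<open>
  Time samples contained in the interval from \<open>p\<close> to \<open>q\<close>.
\<close>

definition sample_in :: "real \<Rightarrow> real \<Rightarrow> real set \<Rightarrow> bool" where
  "sample_in p q S \<longleftrightarrow>
    (\<exists>(k::nat) a b.
       (\<forall>i<k. p \<le> a i \<and> a i < b i \<and> b i \<le> q) \<and>
       (\<forall>i. Suc i < k \<longrightarrow> b i < a (Suc i)) \<and>
       S = (\<Union>i<k. {a i..<b i}))"

lemma time_sample_iff: "time_sample w S \<longleftrightarrow> sample_in 0 (tlen w) S"
  by (simp add: time_sample_def sample_in_def)

lemma sample_in_empty: "sample_in p q {}"
  unfolding sample_in_def by (rule exI[of _ 0]) simp

lemma sample_in_mono: assumes "sample_in p q S" "p' \<le> p" shows "sample_in p' q S"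
proof -
  from assms obtain k :: nat and a b where "\<forall>i<k. p \<le> a i \<and> a i < b i \<and> b i \<le> q"
    "\<forall>i. Suc i < k \<longrightarrow> b i < a (Suc i)" "S = (\<Union>i<k. {a i..<b i})"
    unfolding sample_in_def by blast
  with assms(2) show ?thesis unfolding sample_in_def
    by (intro exI[of _ k] exI[of _ a] exI[of _ b]) auto
qed

lemma sample_in_subset: "sample_in p q S \<Longrightarrow> S \<subseteq> {p..<q}"
  unfolding sample_in_def by fastforce

lemma sample_in_sets: "sample_in p q S \<Longrightarrow> S \<in> sets lborel"
  unfolding sample_in_def by auto

lemma sample_in_interval_Un:
  assumes "sample_in q r S" "p < q" "q \<le> r" shows "sample_in p r ({p..<q} \<union> S)"
proof -
  obtain k :: nat and a b where k: "\<And>i. i < k \<Longrightarrow> q \<le> a i \<and> a i < b i \<and> b i \<le> r"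
    "\<And>i. Suc i < k \<Longrightarrow> b i < a (Suc i)" "S = (\<Union>i<k. {a i..<b i})"
    using assms(1) unfolding sample_in_def by auto
  show ?thesis
  proof (cases "0 < k \<and> a 0 = q")
    case True
    define a' where "a' = a(0 := p)"
    have "{p..<q} \<union> {a i..<b i} = {a' i..<b i}" if "i = 0" for i
      using True k(1)[of 0] assms(2) that by (auto simp: a'_def)
    moreover have "{a i..<b i} = {a' i..<b i}" if "i \<noteq> 0" for i using that by (simp add: a'_def)
    moreover have k0: "{..<k} = insert 0 {0<..<k}" using True by auto
    ultimately have "{p..<q} \<union> S = (\<Union>i<k. {a' i..<b i})"
      unfolding k(3) k0 UN_insert Un_assoc[symmetric] by (simp cong: SUP_cong_simp)
    moreover have "p \<le> a' i \<and> a' i < b i \<and> b i \<le> r" if "i < k" for i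
      using k(1)[OF that] assms(2) True by (cases "i = 0") (simp_all add: a'_def)
    moreover have "b i < a' (Suc i)" if "Suc i < k" for i
      using k(2)[OF that] by (simp add: a'_def)
    ultimately show ?thesis unfolding sample_in_def by blast
  next
    case False
    define a' b' where "a' = case_nat p a" and "b' = case_nat q b"
    have "(\<Union>i<Suc k. {a' i..<b' i}) = {a' 0..<b' 0} \<union> (\<Union>i<k. {a' (Suc i)..<b' (Suc i)})"
      by (simp add: lessThan_Suc_eq_insert_0)
    then have "{p..<q} \<union> S = (\<Union>i<Suc k. {a' i..<b' i})"
      by (simp add: a'_def b'_def k(3))
    moreover have "p \<le> a' i \<and> a' i < b' i \<and> b' i \<le> r" if "i < Suc k" for i
      using that assms k(1)[of "i - 1"] by (cases i) (simp_all add: a'_def b'_def)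
    moreover have "b' i < a' (Suc i)" if "Suc i < Suc k" for i
      using that False k(1)[of 0] k(2)[of "i - 1"] by (cases i) (simp_all add: a'_def b'_def)
    ultimately show ?thesis unfolding sample_in_def by blast
  qed
qed

lemma subword_eq_slices:
  assumes "is_tword w" "time_sample w S"
  shows "subword w S = norm_word (slices 0 w S)"
proof -
  have S: "S \<in> sets lborel" "S \<subseteq> {0..<tlen w}"
    using assms(2) sample_in_sets sample_in_subset by (auto simp: time_sample_iff)
  have w: "nonneg w" using assms(1) by (auto simp: is_tword_iff nonneg_def less_imp_le)
  have "S \<inter> {0..<tlen w} = S" using S(2) by auto
  then have len: "tlen (norm_word (slices 0 w S)) = measure lborel S"
    using tlen_slices[OF S(1) w, of 0] by (simp add: nonneg_slices)
  have tf: "tfun (norm_word (slices 0 w S)) t = tfun w (sample_pos w S t)"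
    if "t \<in> {0..<measure lborel S}" for t
  proof -
    note sp = sample_pos_greatest[OF S, of t]
    have t: "0 \<le> t" "t < measure lborel S" using that by auto
    have "tfun (norm_word (slices 0 w S)) t =
        tfun (slices 0 w S) (measure lborel (S \<inter> {0..<sample_pos w S t}))"
      using sp(3)[OF t w] t by (simp add: tfun_norm nonneg_slices)
    also have "\<dots> = tfun w (sample_pos w S t - 0)"
      by (rule tfun_slices[OF S(1) w]) (use sp[OF t w] in auto)
    finally show ?thesis by simp
  qed
  show ?thesis unfolding subword_def
  proof (rule the_equality)
    show "is_tword (norm_word (slices 0 w S)) \<and> tlen (norm_word (slices 0 w S)) = measure lborel S \<and>
      (\<forall>t\<in>{0..<measure lborel S}. tfun (norm_word (slices 0 w S)) t = tfun w (sample_pos w S t))"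
      using len tf is_tword_norm by blast
  next
    fix v assume "is_tword v \<and> tlen v = measure lborel S \<and>
      (\<forall>t\<in>{0..<measure lborel S}. tfun v t = tfun w (sample_pos w S t))"
    then show "v = norm_word (slices 0 w S)"
      using len tf is_tword_norm by (intro tword_unique) auto
  qed
qed

text \<open>
  The letters of the pieces of positive length.
\<close>

definition pos_letters :: "tword \<Rightarrow> nat list" where
  "pos_letters w = map fst (filter (\<lambda>p. 0 < snd p) w)"

lemma pos_letters_simps [simp]: "pos_letters [] = []"
  "pos_letters (p # w) = (if 0 < snd p then fst p # pos_letters w else pos_letters w)"
  by (simp_all add: pos_letters_def)

lemma timed_row_subword_iff:
  "is_tword w \<Longrightarrow> time_sample w S \<Longrightarrow>
    timed_row (subword w S) \<longleftrightarrow> sorted (pos_letters (slices 0 w S))"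
  by (simp add: subword_eq_slices timed_row_norm pos_letters_def)

lemma image_mset_remove:
  fixes r :: nat
  shows "i < r \<Longrightarrow> image_mset m (mset_set {..<r}) =
    add_mset (m i) (image_mset m (mset_set ({..<r} - {i})))"
  using mset_set.remove[of "{..<r}" i] by simp

lemma image_mset_update:
  fixes r :: nat
  assumes "i < r"
  shows "image_mset (m(i := c)) (mset_set {..<r}) =
    add_mset c (image_mset m (mset_set ({..<r} - {i})))"
proof -
  have "image_mset (m(i := c)) (mset_set ({..<r} - {i})) = image_mset m (mset_set ({..<r} - {i}))"
    by (intro image_mset_cong) auto
  then show ?thesis using image_mset_remove[OF assms, of "m(i := c)"] by simp
qed

text \<open>
  The samples \<open>S i\<close> may share a piece. In the recursion the piece is then given to only one of
  them; the states of the others stay lower than necessary, which does no harm.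
\<close>

lemma gain_of_samples:
  fixes S :: "nat \<Rightarrow> real set"
  assumes "nonneg w" "\<And>i. i < r \<Longrightarrow> S i \<in> sets lborel" "disjoint_family_on S {..<r}"
    and "\<And>i. i < r \<Longrightarrow> sorted (m i # pos_letters (slices p w (S i)))"
  shows "gain w (image_mset m (mset_set {..<r})) (\<Sum>i<r. tlen (slices p w (S i)))"
  using assms(1,4)
proof (induction w arbitrary: p m)
  case (Cons q w)
  obtain c s where q: "q = (c, s)" by force
  define x where "x i = measure lborel (S i \<inter> {p..<p + s})" for i
  define g where "g = (\<Sum>i<r. tlen (slices (p + s) w (S i)))"
  have tot: "(\<Sum>i<r. tlen (slices p (q # w) (S i))) = (\<Sum>i<r. x i) + g"
    by (simp add: q x_def g_def sum.distrib)
  have x0: "0 \<le> x i" for i by (simp add: x_def)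
  have s: "0 \<le> s" "nonneg w" using Cons.prems(1) q by auto
  have "(\<Sum>i<r. x i) = measure lborel (\<Union>i<r. S i \<inter> {p..<p + s})"
    unfolding x_def
  proof (rule measure_finite_Union[symmetric])
    show "emeasure lborel (S i \<inter> {p..<p + s}) \<noteq> \<infinity>" if "i \<in> {..<r}" for i
    proof -
      have "emeasure lborel (S i \<inter> {p..<p + s}) \<le> emeasure lborel {p..<p + s}"
        by (rule emeasure_mono) auto
      then show ?thesis using s by (auto simp: top_unique)
    qed
  qed (use assms(2,3) in \<open>auto simp: disjoint_family_on_def\<close>)
  also have "(\<Union>i<r. S i \<inter> {p..<p + s}) = (\<Union>i<r. S i) \<inter> {p..<p + s}" by auto
  also have "measure lborel \<dots> \<le> s"
    using measure_Int_interval_le[of "\<Union>i<r. S i" p "p + s"] s assms(2) by auto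
  finally have xs: "(\<Sum>i<r. x i) \<le> s" .
  have sorted: "sorted (m i # (if 0 < x i then c # pos_letters (slices (p + s) w (S i))
      else pos_letters (slices (p + s) w (S i))))" if "i < r" for i
    using Cons.prems(2)[OF that]
    by (simp only: q x_def slices.simps pos_letters_simps fst_conv snd_conv)
  show ?case
  proof (cases "\<exists>i<r. 0 < x i")
    case False
    then have "x i = 0" if "i < r" for i using x0[of i] that by force
    then have "(\<Sum>i<r. x i) = 0" by simp
    moreover have "gain w (image_mset m (mset_set {..<r})) g"
      unfolding g_def
      by (rule Cons.IH[OF s(2)]) (use sorted False in force)
    ultimately show ?thesis using tot by (simp add: gain_skip)
  next
    case True
    then obtain i where i: "i < r" "0 < x i" by blast
    have mi: "m i \<le> c" using sorted[OF i(1)] i(2) by simp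
    have "gain w (image_mset (m(i := c)) (mset_set {..<r})) g"
      unfolding g_def
    proof (rule Cons.IH[OF s(2)])
      show "sorted ((m(i := c)) j # pos_letters (slices (p + s) w (S j)))" if "j < r" for j
        using sorted[OF that] i(2) by (cases "j = i") (auto split: if_splits)
    qed
    then have "gain w (add_mset c (image_mset m (mset_set ({..<r} - {i})))) g"
      using image_mset_update[OF i(1), of m c] by simp
    then have "gain w (add_mset c (image_mset m (mset_set ({..<r} - {i})))) ((\<Sum>i<r. x i) + g - s)"
      by (rule gain_down) (use xs in simp)
    then show ?thesis
      unfolding tot unfolding q image_mset_remove[OF i(1), of m] using mi by (rule gain_take)
  qed
qed simp

lemma samples_of_gain:
  fixes r :: nat
  assumes "\<forall>q\<in>set w. 0 < snd q" "gain w (image_mset m (mset_set {..<r})) g"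
  shows "\<exists>S. (\<forall>i<r. sample_in p (p + tlen w) (S i) \<and> sorted (m i # pos_letters (slices p w (S i)))) \<and>
    disjoint_family_on S {..<r} \<and> g \<le> (\<Sum>i<r. measure lborel (S i))"
  using assms
proof (induction w arbitrary: p m g)
  case Nil
  then show ?case
    by (intro exI[of _ "\<lambda>_. {}"]) (auto simp: sample_in_empty disjoint_family_on_def)
next
  case (Cons q w)
  obtain c s where q: "q = (c, s)" by force
  have s: "0 < s" and pos: "\<forall>q\<in>set w. 0 < snd q" using Cons.prems(1) q by auto
  have nn: "nonneg w" using pos by (auto simp: nonneg_def less_imp_le)
  have w0: "0 \<le> tlen w" using nn by (rule tlen_nonneg)
  from Cons.prems(2)[unfolded q] show ?case
  proof (cases rule: gain_Cons_cases)
    case 1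
    obtain S where S: "\<And>i. i < r \<Longrightarrow> sample_in (p + s) (p + s + tlen w) (S i)"
      "\<And>i. i < r \<Longrightarrow> sorted (m i # pos_letters (slices (p + s) w (S i)))"
      "disjoint_family_on S {..<r}" "g \<le> (\<Sum>i<r. measure lborel (S i))"
      using Cons.IH[OF pos 1, of "p + s"] by blast
    show ?thesis
    proof (intro exI[of _ S] conjI allI impI)
      fix i assume i: "i < r"
      show "sample_in p (p + tlen (q # w)) (S i)"
        using sample_in_mono[OF S(1)[OF i]] s by (simp add: q add.assoc)
      have "S i \<inter> {p..<p + s} = {}" using sample_in_subset[OF S(1)[OF i]] by fastforce
      then show "sorted (m i # pos_letters (slices p (q # w) (S i)))"
        using S(2)[OF i] by (simp add: q)
    qed (use S in auto)
  next
    case (2 a N)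
    have "a \<in># image_mset m (mset_set {..<r})" using 2(1) by simp
    then obtain i0 where i0: "i0 < r" "m i0 = a" by (auto simp: image_iff)
    have N: "N = image_mset m (mset_set ({..<r} - {i0}))"
      using 2(1) image_mset_remove[OF i0(1), of m] i0(2) by simp
    have "gain w (image_mset (m(i0 := c)) (mset_set {..<r})) (g - s)"
      using 2(3) N image_mset_update[OF i0(1), of m c] by simp
    from Cons.IH[OF pos this, of "p + s"] obtain S where
      S: "\<And>i. i < r \<Longrightarrow> sample_in (p + s) (p + s + tlen w) (S i)"
      "\<And>i. i < r \<Longrightarrow> sorted ((m(i0 := c)) i # pos_letters (slices (p + s) w (S i)))"
      "disjoint_family_on S {..<r}" "g - s \<le> (\<Sum>i<r. measure lborel (S i))"
      by blast
    have sub: "S i \<subseteq> {p + s..<p + s + tlen w}" if "i < r" for i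
      using sample_in_subset[OF S(1)[OF that]] .
    define T where "T = S(i0 := {p..<p + s} \<union> S i0)"
    show ?thesis
    proof (intro exI[of _ T] conjI allI impI)
      fix i assume i: "i < r"
      show "sample_in p (p + tlen (q # w)) (T i)"
        using sample_in_mono[OF S(1)[OF i], of p] sample_in_interval_Un[OF S(1)[OF i], of p] s w0
        by (auto simp: q add.assoc T_def)
      have "slices (p + s) w (T i) = slices (p + s) w (S i)"
        by (rule slices_cong[OF nn]) (auto simp: T_def)
      moreover have "T i \<inter> {p..<p + s} = (if i = i0 then {p..<p + s} else {})"
        using sub[OF i] by (force simp: T_def)
      ultimately show "sorted (m i # pos_letters (slices p (q # w) (T i)))"
        using S(2)[OF i] s 2(2) i0(2) by (auto simp: q)
    next
      show "disjoint_family_on T {..<r}"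
        unfolding disjoint_family_on_def
      proof (intro ballI impI)
        fix j l assume jl: "j \<in> {..<r}" "l \<in> {..<r}" "j \<noteq> l"
        then have "S j \<inter> S l = {}" using S(3) by (simp add: disjoint_family_on_def)
        moreover have "{p..<p + s} \<inter> S j = {}" "{p..<p + s} \<inter> S l = {}"
          using sub[of j] sub[of l] jl by fastforce+
        ultimately show "T j \<inter> T l = {}" using jl(3) unfolding T_def fun_upd_apply by auto
      qed
      have "measure lborel ({p..<p + s} \<union> S i0) = s + measure lborel (S i0)"
      proof -
        have "{p..<p + s} \<inter> S i0 = {}" using sub[OF i0(1)] by fastforce
        moreover have "S i0 \<in> fmeasurable lborel"
          by (rule fmeasurableI2[of "{p + s..<p + s + tlen w}"])
            (use sub[OF i0(1)] sample_in_sets[OF S(1)[OF i0(1)]] w0 in \<open>auto simp: fmeasurable_def\<close>)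
        moreover have "{p..<p + s} \<in> fmeasurable lborel"
          using s by (auto simp: fmeasurable_def)
        ultimately show ?thesis using s by (subst measure_Un3) simp_all
      qed
      then have "(\<Sum>i<r. measure lborel (T i)) = s + (\<Sum>i<r. measure lborel (S i))"
        using i0(1) by (simp add: sum.remove[of "{..<r}" i0] T_def)
      then show "g \<le> (\<Sum>i<r. measure lborel (T i))" using S(4) by simp
    qed
  qed
qed

lemma image_mset_zero: "image_mset (\<lambda>_. 0) (mset_set {..<r}) = replicate_mset r (0::nat)"
  by (induction r) (simp_all add: lessThan_Suc)

lemma greene_conv_Sup_gain:
  assumes "is_tword w"
  shows "greene r w = Sup {g. gain w (replicate_mset r 0) g}"
proof -
  define X where "X = {(\<Sum>i<r. measure lborel (S i)) | S.
           (\<forall>i<r. time_sample w (S i) \<and> timed_row (subword w (S i))) \<and>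
           disjoint_family_on S {..<r}}"
  define Y where "Y = {g. gain w (replicate_mset r 0) g}"
  have pos: "\<forall>q\<in>set w. 0 < snd q" using assms by (simp add: is_tword_iff)
  have w: "nonneg w" using pos by (auto simp: nonneg_def less_imp_le)
  have bdd: "y \<le> tlen w" if "y \<in> Y" for y using that gain_le_tlen[OF w] by (simp add: Y_def)
  have XY: "X \<subseteq> Y"
  proof
    fix g assume "g \<in> X"
    then obtain S where S: "g = (\<Sum>i<r. measure lborel (S i))"
      "\<And>i. i < r \<Longrightarrow> time_sample w (S i)" "\<And>i. i < r \<Longrightarrow> timed_row (subword w (S i))"
      "disjoint_family_on S {..<r}"
      unfolding X_def by blast
    have "sample_in 0 (tlen w) (S i)" if "i < r" for i
      using S(2)[OF that] by (simp add: time_sample_iff)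
    then have sets: "S i \<in> sets lborel" "S i \<inter> {0..<0 + tlen w} = S i" if "i < r" for i
      using sample_in_sets[of 0 "tlen w" "S i"] sample_in_subset[of 0 "tlen w" "S i"] that by auto
    have "gain w (image_mset (\<lambda>_. 0) (mset_set {..<r})) (\<Sum>i<r. tlen (slices 0 w (S i)))"
      by (rule gain_of_samples[OF w]) (use S sets assms in \<open>auto simp: timed_row_subword_iff\<close>)
    moreover have "(\<Sum>i<r. tlen (slices 0 w (S i))) = g"
      unfolding S(1) by (rule sum.cong) (use sets w in \<open>simp_all add: tlen_slices\<close>)
    ultimately show "g \<in> Y" by (simp add: Y_def image_mset_zero)
  qed
  have YX: "\<exists>x\<in>X. y \<le> x" if "y \<in> Y" for y
  proof -
    have "gain w (image_mset (\<lambda>_. 0) (mset_set {..<r})) y"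
      using that by (simp add: Y_def image_mset_zero)
    from samples_of_gain[OF pos this, of 0] obtain S where
      S: "\<And>i. i < r \<Longrightarrow> time_sample w (S i)"
      "\<And>i. i < r \<Longrightarrow> sorted (pos_letters (slices 0 w (S i)))"
      "disjoint_family_on S {..<r}" "y \<le> (\<Sum>i<r. measure lborel (S i))"
      by (auto simp: time_sample_iff)
    then have "(\<Sum>i<r. measure lborel (S i)) \<in> X"
      unfolding X_def using assms by (auto simp: timed_row_subword_iff)
    then show ?thesis using S(4) by blast
  qed
  have "gain w (replicate_mset r 0) 0"
  proof -
    have "gain v M 0" for v M by (induction v) (simp_all add: gain_skip)
    then show ?thesis .
  qed
  then have Y0: "0 \<in> Y" by (simp add: Y_def)
  then have "X \<noteq> {}" using YX by blast
  have "Sup X = Sup Y"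
  proof (rule antisym)
    show "Sup X \<le> Sup Y"
      by (rule cSup_subset_mono[OF \<open>X \<noteq> {}\<close> _ XY]) (use bdd in \<open>auto simp: bdd_above_def\<close>)
    show "Sup Y \<le> Sup X"
      by (rule cSup_mono) (use Y0 YX bdd XY in \<open>auto simp: bdd_above_def\<close>)
  qed
  then show ?thesis by (simp add: greene_def X_def Y_def)
qed

lemma tableau_word_0 [simp]: "tableau_word 0 k t = []"
  by (simp add: tableau_word_def)

lemma tableau_word_Suc: "tableau_word (Suc q) k t = row_word 1 k (t (Suc q)) @ tableau_word q k t"
  by (simp add: tableau_word_def)

lemma filter_row_word:
  assumes "k \<le> n" shows "filter (\<lambda>p. fst p \<le> k) (row_word 1 n f) = row_word 1 k f"
proof -
  have "[1..<Suc n] = [1..<Suc k] @ [Suc k..<Suc n]"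
    using assms upt_add_eq_append[of 1 "Suc k" "n - k"] by simp
  then show ?thesis unfolding row_word_def filter_map comp_def
    by (simp add: filter_id_conv filter_empty_conv del: upt_Suc)
qed

lemma filter_tableau_word:
  "k \<le> n \<Longrightarrow> filter (\<lambda>p. fst p \<le> k) (tableau_word q n t) = tableau_word q k t"
  by (induction q) (simp_all add: tableau_word_Suc filter_row_word del: One_nat_def)

lemma nonneg_tableau_word: "tableau t \<Longrightarrow> nonneg (tableau_word q k t)"
  by (auto simp: tableau_word_def row_word_def tableau_def nonneg_def)

section \<open>Recovering a tableau from Greene invariants\<close>

text \<open>
  The word \<open>k\<^bsup>N\<^esup> (k - 1)\<^bsup>N\<^esup> \<dots> (k - r + 1)\<^bsup>N\<^esup>\<close>.
\<close>

definition staircase :: "real \<Rightarrow> nat \<Rightarrow> nat \<Rightarrow> tword" where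
  "staircase N k r = map (\<lambda>i. (k - i, N)) [0..<r]"

lemma tlen_staircase: "tlen (staircase N k r) = real r * N"
  by (simp add: staircase_def tlen_def comp_def sum_list_triv)

lemma size_filter_mset_mono:
  "(\<And>x. P x \<Longrightarrow> Q x) \<Longrightarrow> size (filter_mset P M) \<le> size (filter_mset Q M)"
  by (induction M) (auto simp: le_SucI)

lemma gain_staircase_le:
  assumes "a \<le> b" "b \<le> k" "0 \<le> N" "gain (map (\<lambda>i. (k - i, N)) [a..<b]) M g"
  shows "g \<le> N * real (size {#m \<in># M. m \<le> k - a#})"
  using assms(1,4)
proof (induction arbitrary: M g rule: inc_induct)
  case base
  then have "g \<le> 0" by simp
  also have "0 \<le> N * real (size {#m \<in># M. m \<le> k - b#})" using assms(3) by simp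
  finally show ?case .
next
  case (step a)
  have mono: "size {#m \<in># M. m \<le> k - Suc a#} \<le> size {#m \<in># M. m \<le> k - a#}" for M :: "nat multiset"
    by (rule size_filter_mset_mono) simp
  have "gain ((k - a, N) # map (\<lambda>i. (k - i, N)) [Suc a..<b]) M g"
    using step.prems step.hyps by (simp add: upt_conv_Cons)
  then show ?case
  proof (cases rule: gain_Cons_cases)
    case 1
    have "g \<le> N * real (size {#m \<in># M. m \<le> k - Suc a#})" by (rule step.IH[OF 1])
    also have "\<dots> \<le> N * real (size {#m \<in># M. m \<le> k - a#})"
      using mono assms(3) by (intro mult_left_mono) auto
    finally show ?thesis .
  next
    case (2 m M')
    have "k - Suc a < k - a" using step.hyps assms(2) by simp
    then have "g - N \<le> N * real (size {#m \<in># M'. m \<le> k - Suc a#})"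
      using step.IH[OF 2(3)] by simp
    also have "\<dots> \<le> N * real (size {#m \<in># M'. m \<le> k - a#})"
      using mono assms(3) by (intro mult_left_mono) auto
    finally show ?thesis using 2 by (simp add: algebra_simps)
  qed
qed

text \<open>
  A chain that has passed a letter greater than \<open>k\<close> cannot use the staircase.
\<close>

lemma gain_staircase_dead:
  assumes "\<exists>m\<in>#M. k < m" "r \<le> k" "0 \<le> N" "nonneg w" "gain (w @ staircase N k r) M g"
  shows "g \<le> tlen w + N * real (size M - 1)"
  using assms(1,4,5)
proof (induction w arbitrary: M g)
  case Nil
  obtain m M' where M: "M = add_mset m M'" "k < m"
    using Nil.prems(1) by (auto dest: multi_member_split)
  have "g \<le> N * real (size {#m \<in># M. m \<le> k#})"
    using gain_staircase_le[of 0 r k N M g] Nil.prems(3) assms(2,3) by (simp add: staircase_def)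
  also have "\<dots> \<le> N * real (size M - 1)"
    using M size_filter_mset_lesseq[of "\<lambda>m. m \<le> k" M'] assms(3) by (intro mult_left_mono) auto
  finally show ?case by simp
next
  case (Cons p w)
  obtain c s where p: "p = (c, s)" by force
  have "gain ((c, s) # (w @ staircase N k r)) M g" using Cons.prems p by simp
  then show ?case
  proof (cases rule: gain_Cons_cases)
    case 1
    then show ?thesis using Cons.IH[OF Cons.prems(1) _ 1] Cons.prems(2) p by simp
  next
    case (2 m M')
    have "\<exists>m\<in>#add_mset c M'. k < m" using Cons.prems(1) 2(1,2) by auto
    from Cons.IH[OF this _ 2(3)] show ?thesis using Cons.prems(2) p 2(1) by simp
  qed
qed

lemma gain_staircase_cases:
  assumes "r \<le> k" "0 \<le> N" "nonneg w" "gain (w @ staircase N k r) M g"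
  shows "gain (filter (\<lambda>p. fst p \<le> k) w @ staircase N k r) M g \<or>
    g \<le> tlen w + N * real (size M - 1)"
  using assms(3,4)
proof (induction w arbitrary: M g)
  case (Cons p w)
  obtain c s where p: "p = (c, s)" by force
  have w: "nonneg w" "0 \<le> s" using Cons.prems p by auto
  have "gain ((c, s) # (w @ staircase N k r)) M g" using Cons.prems p by simp
  then show ?case
  proof (cases rule: gain_Cons_cases)
    case 1
    then show ?thesis using Cons.IH[OF w(1) 1] w(2) p by (auto intro: gain_skip)
  next
    case (2 m M')
    show ?thesis
    proof (cases "c \<le> k")
      case True
      then show ?thesis using Cons.IH[OF w(1) 2(3)] 2(1,2) p by auto
    next
      case False
      then have "g - s \<le> tlen w + N * real (size (add_mset c M') - 1)"
        by (intro gain_staircase_dead[OF _ assms(1,2) w(1) 2(3)]) auto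
      then show ?thesis using 2(1) p by simp
    qed
  qed
qed simp

text \<open>
  A dual bound. The function \<open>c\<close> gives the column at which the letters at most \<open>j\<close> of the current
  row end. Among the columns left of \<open>C\<close>, a chain with last letter \<open>m\<close> can only use those right of
  column \<open>c m\<close>, or \<open>c (m - 1)\<close> if the letter \<open>m\<close> of this row is still to come; the columns right
  of \<open>C\<close> are counted in full. The potential \<open>\<psi>\<close> and the constant \<open>e\<close> bound what the remaining word
  contributes.
\<close>

lemma gain_row_word_le:
  fixes f c :: "nat \<Rightarrow> real"
  assumes f: "\<And>j. 0 \<le> f j" and c: "\<And>j. c j = (\<Sum>l = 1..j. f l)"
    and rest: "\<And>M g. gain rest M g \<Longrightarrow> g \<le> (\<Sum>m\<in>#M. \<psi> m) + e"
    and \<psi>: "\<And>m. \<psi> m \<le> C - min C (c (if m \<le> k then m else m - 1))"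
    and j: "1 \<le> j" "j \<le> Suc k" and g: "gain (row_word j k f @ rest) M g"
  shows "g \<le> (\<Sum>m\<in>#M. C - min C (c (if m < j then m else m - 1))) +
    (\<Sum>l = j..k. f l - (min C (c l) - min C (c (l - 1)))) + e"
  using j(2,1) g
proof (induction arbitrary: M g rule: inc_induct)
  case base
  then have "gain rest M g" by (simp add: row_word_def)
  from rest[OF this] have "g \<le> (\<Sum>m\<in>#M. \<psi> m) + e" .
  also have "(\<Sum>m\<in>#M. \<psi> m) \<le> (\<Sum>m\<in>#M. C - min C (c (if m < Suc k then m else m - 1)))"
    using \<psi> by (intro sum_mset_mono) (simp add: less_Suc_eq_le)
  finally show ?case by simp
next
  case (step j)
  let ?\<phi> = "\<lambda>j m. C - min C (c (if m < j then m else m - 1))"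
  let ?x = "\<lambda>l. f l - (min C (c l) - min C (c (l - 1)))"
  have c_Suc: "c (Suc l) = c l + f (Suc l)" for l by (simp add: c)
  have c_mono: "c l \<le> c l'" if "l \<le> l'" for l l'
    using that by (rule lift_Suc_mono_le[rotated]) (simp add: c_Suc f)
  have cj: "c j = c (j - 1) + f j" using c_Suc[of "j - 1"] step.prems(1) by simp
  have \<phi>_mono: "?\<phi> (Suc j) m \<le> ?\<phi> j m" for m
    using c_mono[of "j - 1" j] by (cases "m = j") (auto simp: less_Suc_eq)
  have x: "0 \<le> ?x j" using cj f[of j] by (simp add: min_def)
  have jk: "(\<Sum>l = j..k. ?x l) = ?x j + (\<Sum>l = Suc j..k. ?x l)"
    using step.hyps by (simp add: sum.atLeast_Suc_atMost)
  have "row_word j k f = (j, f j) # row_word (Suc j) k f"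
    using step.hyps by (simp add: row_word_def upt_conv_Cons del: upt_Suc)
  then have "gain ((j, f j) # (row_word (Suc j) k f @ rest)) M g" using step.prems by simp
  then show ?case
  proof (cases rule: gain_Cons_cases)
    case 1
    have "g \<le> (\<Sum>m\<in>#M. ?\<phi> (Suc j) m) + (\<Sum>l = Suc j..k. ?x l) + e"
      by (rule step.IH[OF _ 1]) simp
    moreover have "(\<Sum>m\<in>#M. ?\<phi> (Suc j) m) \<le> (\<Sum>m\<in>#M. ?\<phi> j m)"
      by (intro sum_mset_mono \<phi>_mono)
    ultimately show ?thesis using jk x by linarith
  next
    case (2 m M')
    have "g - f j \<le> (\<Sum>m\<in>#add_mset j M'. ?\<phi> (Suc j) m) + (\<Sum>l = Suc j..k. ?x l) + e"
      by (rule step.IH[OF _ 2(3)]) simp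
    then have "g - f j \<le> C - min C (c j) + (\<Sum>m\<in>#M'. ?\<phi> (Suc j) m) + (\<Sum>l = Suc j..k. ?x l) + e"
      by simp
    moreover have "(\<Sum>m\<in>#M'. ?\<phi> (Suc j) m) \<le> (\<Sum>m\<in>#M'. ?\<phi> j m)"
      by (intro sum_mset_mono \<phi>_mono)
    moreover have "C - min C (c (j - 1)) \<le> ?\<phi> j m"
    proof (cases "m = j")
      case False
      then have "m < j" "m \<le> j - 1" using 2(2) by auto
      then show ?thesis using c_mono[of m "j - 1"] by (auto simp: min_def)
    qed simp
    moreover have "(\<Sum>m\<in>#M. ?\<phi> j m) = ?\<phi> j m + (\<Sum>m\<in>#M'. ?\<phi> j m)"
      unfolding 2(1) by simp
    ultimately show ?thesis using jk by linarith
  qed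
qed

text \<open>
  The length of the letters at most \<open>k\<close> in row \<open>i\<close>.
\<close>

definition cum :: "(nat \<Rightarrow> nat \<Rightarrow> real) \<Rightarrow> nat \<Rightarrow> nat \<Rightarrow> real" where
  "cum t i k = (\<Sum>j = 1..k. t i j)"

lemma cum_0 [simp]: "cum t i 0 = 0"
  by (simp add: cum_def)

lemma cum_Suc: "cum t i (Suc k) = cum t i k + t i (Suc k)"
  by (simp add: cum_def)

lemma cum_mono: "tableau t \<Longrightarrow> k \<le> l \<Longrightarrow> cum t i k \<le> cum t i l"
  unfolding cum_def by (rule sum_mono2) (auto simp: tableau_def)

lemma cum_nonneg: "tableau t \<Longrightarrow> 0 \<le> cum t i k"
  using cum_mono[of t 0 k i] by simp

lemma cum_dominated: "tableau t \<Longrightarrow> 1 \<le> i \<Longrightarrow> cum t (Suc i) (Suc k) \<le> cum t i k"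
  by (simp add: tableau_def cum_def)

lemma cum_antimono: "tableau t \<Longrightarrow> 1 \<le> i \<Longrightarrow> i \<le> j \<Longrightarrow> cum t j k \<le> cum t i k"
proof -
  assume t: "tableau t" "1 \<le> i"
  assume "i \<le> j" then show ?thesis
  proof (induction rule: dec_induct)
    case (step j)
    have "cum t (Suc j) k \<le> cum t (Suc j) (Suc k)" using t(1) by (rule cum_mono) simp
    also have "\<dots> \<le> cum t j k" using t step.hyps by (intro cum_dominated) auto
    finally show ?case using step.IH by simp
  qed simp
qed

lemma cum_below_diagonal: "tableau t \<Longrightarrow> 1 \<le> i \<Longrightarrow> cum t i (i - 1) = 0"
proof -
  assume t: "tableau t"
  have "cum t (Suc i) i \<le> 0" for i
  proof (induction i)
    case (Suc i)
    then show ?case using cum_dominated[OF t, of "Suc i" i] by simp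
  qed simp
  then show "1 \<le> i \<Longrightarrow> cum t i (i - 1) = 0"
    using cum_nonneg[OF t, of i "i - 1"] by (cases i) (auto intro: antisym)
qed

lemma gain_tableau_word_le:
  assumes t: "tableau t" and v: "nonneg v" and C: "0 \<le> C" and g: "gain (tableau_word q k t @ v) M g"
  shows "g \<le> (\<Sum>m\<in>#M. if q = 0 then 0 else C - min C (cum t q (m - 1))) +
    (\<Sum>i = 1..q. cum t i k - min C (cum t i k)) + tlen v"
  using g
proof (induction q arbitrary: M g)
  case 0
  then show ?case using gain_le_tlen[OF v] by simp
next
  case (Suc q)
  let ?\<psi> = "\<lambda>m. if q = 0 then 0 else C - min C (cum t q (m - 1))"
  let ?E = "\<Sum>i = 1..q. cum t i k - min C (cum t i k)"
  have \<psi>: "?\<psi> m \<le> C - min C (cum t (Suc q) (if m \<le> k then m else m - 1))" for m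
  proof (cases "q = 0 \<or> m = 0")
    case False
    then have "cum t (Suc q) m \<le> cum t q (m - 1)" using cum_dominated[OF t, of q "m - 1"] by simp
    moreover have "cum t (Suc q) (m - 1) \<le> cum t (Suc q) m" by (rule cum_mono[OF t]) simp
    ultimately show ?thesis using False by (auto simp: min_def)
  qed (auto simp: C)
  have tel: "(\<Sum>l = 1..k. t i l - (min C (cum t i l) - min C (cum t i (l - 1)))) =
      cum t i k - min C (cum t i k)" for i
  proof (induction k)
    case 0
    then show ?case using C by simp
  qed (simp add: cum_Suc)
  have "g \<le> (\<Sum>m\<in>#M. C - min C (cum t (Suc q) (if m < 1 then m else m - 1))) +
      (\<Sum>l = 1..k. t (Suc q) l - (min C (cum t (Suc q) l) - min C (cum t (Suc q) (l - 1)))) +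
      (?E + tlen v)"
  proof (rule gain_row_word_le[where \<psi> = ?\<psi>])
    show "g \<le> (\<Sum>m\<in>#M. ?\<psi> m) + (?E + tlen v)" if "gain (tableau_word q k t @ v) M g" for M g
      using Suc.IH[OF that] by simp
    show "gain (row_word 1 k (t (Suc q)) @ tableau_word q k t @ v) M g"
      using Suc.prems by (simp add: tableau_word_Suc)
  qed (use t \<psi> in \<open>auto simp: tableau_def cum_def\<close>)
  also have "(\<Sum>m\<in>#M. C - min C (cum t (Suc q) (if m < 1 then m else m - 1))) =
      (\<Sum>m\<in>#M. if Suc q = 0 then 0 else C - min C (cum t (Suc q) (m - 1)))"
    by (intro arg_cong[where f = sum_mset] image_mset_cong) simp
  finally show ?case unfolding tel by simp
qed

text \<open>
  The bound is applied with \<open>C\<close> the length of row \<open>r\<close>, restricted to letters at most \<open>k\<close>: the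
  columns left of \<open>C\<close> count once for each of the \<open>r\<close> chains, and right of \<open>C\<close> only the first
  \<open>r - 1\<close> rows have cells. A family that uses a letter greater than \<open>k\<close> loses a block of the
  staircase, and \<open>N\<close> is large enough for this not to pay.
\<close>

lemma gain_tableau_staircase_le:
  assumes t: "tableau t" and r: "1 \<le> r" "r \<le> k" "k \<le> n" and N: "tlen (tableau_word n n t) \<le> N"
    and g: "gain (tableau_word n n t @ staircase N k r) (replicate_mset r 0) g"
  shows "g \<le> (\<Sum>i = 1..r. cum t i k) + real r * N"
proof -
  have nn: "nonneg (tableau_word n n t)" by (rule nonneg_tableau_word[OF t])
  then have N0: "0 \<le> N" using N tlen_nonneg[OF nn] by simp
  from gain_staircase_cases[OF r(2) N0 nn g] show ?thesis
  proof
    let ?C = "cum t r k"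
    have C: "0 \<le> ?C" by (rule cum_nonneg[OF t])
    assume "gain (filter (\<lambda>p. fst p \<le> k) (tableau_word n n t) @ staircase N k r) (replicate_mset r 0) g"
    then have g: "gain (tableau_word n k t @ staircase N k r) (replicate_mset r 0) g"
      by (simp add: filter_tableau_word r(3))
    have "nonneg (staircase N k r)" using N0 by (auto simp: nonneg_def staircase_def)
    from gain_tableau_word_le[OF t this C g] have
      "g \<le> real r * ?C + (\<Sum>i = 1..n. cum t i k - min ?C (cum t i k)) + real r * N"
      using r C by (simp add: tlen_staircase)
    also have "(\<Sum>i = 1..n. cum t i k - min ?C (cum t i k)) = (\<Sum>i = 1..r. cum t i k - ?C)"
    proof (rule sum.mono_neutral_cong_right)
      show "\<forall>i\<in>{1..n} - {1..r}. cum t i k - min ?C (cum t i k) = 0"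
      proof
        fix i assume "i \<in> {1..n} - {1..r}"
        then have "cum t i k \<le> ?C" by (intro cum_antimono[OF t r(1)]) auto
        then show "cum t i k - min ?C (cum t i k) = 0" by simp
      qed
      show "cum t i k - min ?C (cum t i k) = cum t i k - ?C" if "i \<in> {1..r}" for i
        using cum_antimono[OF t, of i r k] that by (auto simp: min_def)
    qed (use r in auto)
    finally show ?thesis by (simp add: sum_subtractf)
  next
    assume "g \<le> tlen (tableau_word n n t) + N * real (size (replicate_mset r (0::nat)) - 1)"
    also have "\<dots> \<le> N + N * real (r - 1)" using N by simp
    also have "\<dots> = real r * N" using r(1) by (simp add: algebra_simps of_nat_diff)
    also have "\<dots> \<le> (\<Sum>i = 1..r. cum t i k) + real r * N"
      using cum_nonneg[OF t] by (simp add: sum_nonneg)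
    finally show ?thesis .
  qed
qed

lemma gain_append_skip: "gain v M g \<Longrightarrow> gain (u @ v) M g"
  by (induction u) (simp_all add: gain_skip)

lemma gain_stay:
  "set xs \<subseteq> set_mset M \<Longrightarrow> gain v M g \<Longrightarrow>
    gain (map (\<lambda>j. (j, f j)) xs @ v) M (g + sum_list (map f xs))"
proof (induction xs)
  case (Cons x xs)
  then obtain M' where M: "M = add_mset x M'" by (auto dest: multi_member_split)
  have "gain (map (\<lambda>j. (j, f j)) xs @ v) (add_mset x M') (g + sum_list (map f (x # xs)) - f x)"
    using Cons M by simp
  then have "gain ((x, f x) # (map (\<lambda>j. (j, f j)) xs @ v)) (add_mset x M') (g + sum_list (map f (x # xs)))"
    by (rule gain_take) simp
  then show ?case using M by simp
qed simp

lemma gain_climb: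
  "gain v (add_mset d M) g \<Longrightarrow> gain (row_word 1 d f @ v) (add_mset 0 M) (g + (\<Sum>j = 1..d. f j))"
proof (induction d arbitrary: v g)
  case (Suc d)
  have "gain ((Suc d, f (Suc d)) # v) (add_mset d M) (g + f (Suc d))"
    using Suc.prems by - (rule gain_take, simp_all)
  from Suc.IH[OF this] show ?case by (simp add: row_word_def algebra_simps)
qed (simp add: row_word_def)

lemma sum_list_row: "sum_list (map f [a..<Suc b]) = (\<Sum>j = a..b. f j)"
  by (simp add: sum_list_distinct_conv_sum_set atLeastLessThanSuc_atLeastAtMost del: upt_Suc)

text \<open>
  The bound is attained. Before row \<open>r - q\<close> is read, \<open>q\<close> chains have the last letters
  \<open>k, \<dots>, k - q + 1\<close>. They take these letters in the row, and a new chain takes the letters at most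
  \<open>k - q\<close>.
\<close>

lemma gain_tableau_staircase:
  assumes t: "tableau t" and r: "r \<le> k" "k \<le> n"
  shows "gain (tableau_word n n t @ staircase N k r) (replicate_mset r 0)
    ((\<Sum>i = 1..r. cum t i k) + real r * N)"
proof -
  let ?M = "\<lambda>q. mset (map (\<lambda>i. k - i) [0..<q]) + replicate_mset (r - q) 0"
  have main: "gain (tableau_word i k t @ staircase N k r) (?M (r - i)) ((\<Sum>l = 1..i. cum t l k) + real r * N)"
    if "i \<le> r" for i
    using that
  proof (induction i)
    case 0
    have "gain (map (\<lambda>j. (j, N)) (map (\<lambda>i. k - i) [0..<r]) @ []) (?M r)
        (0 + sum_list (map (\<lambda>_. N) (map (\<lambda>i. k - i) [0..<r])))"
      by (rule gain_stay) auto
    then show ?case by (simp add: staircase_def comp_def sum_list_triv)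
  next
    case (Suc i)
    define q where "q = r - Suc i"
    define Z where "Z = mset (map (\<lambda>i. k - i) [0..<q]) + replicate_mset i 0"
    have q: "r - i = Suc q" "r - q = Suc i" "q < r" using Suc.prems by (auto simp: q_def)
    let ?v = "tableau_word i k t @ staircase N k r" and ?G = "(\<Sum>l = 1..i. cum t l k) + real r * N"
    let ?f = "t (Suc i)"
    have "r - Suc q = i" using q by simp
    then have "?M (Suc q) = add_mset (k - q) Z" by (simp add: Z_def)
    then have "gain ?v (add_mset (k - q) Z) ?G" using Suc q by simp
    moreover have "set [Suc (k - q)..<Suc k] \<subseteq> set_mset (add_mset (k - q) Z)"
    proof
      fix j assume "j \<in> set [Suc (k - q)..<Suc k]"
      then have "j = k - (k - j)" "k - j < q" by auto
      then have "j \<in> (\<lambda>i. k - i) ` {0..<q}" by (metis atLeastLessThan_iff imageI zero_le)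
      then show "j \<in> set_mset (add_mset (k - q) Z)" by (simp add: Z_def)
    qed
    ultimately have "gain (row_word (Suc (k - q)) k ?f @ ?v) (add_mset (k - q) Z)
        (?G + (\<Sum>j = Suc (k - q)..k. ?f j))"
      using gain_stay[of "[Suc (k - q)..<Suc k]" "add_mset (k - q) Z" ?v ?G ?f]
      unfolding row_word_def sum_list_row by blast
    note climb = gain_climb[OF this, of ?f]
    have row: "row_word 1 k ?f = row_word 1 (k - q) ?f @ row_word (Suc (k - q)) k ?f"
      using upt_add_eq_append[of 1 "Suc (k - q)" q] q r
      unfolding row_word_def map_append[symmetric] by (simp del: upt_Suc)
    have "(\<Sum>j = Suc (k - q)..k. ?f j) + (\<Sum>j = 1..k - q. ?f j) = cum t (Suc i) k"
      using sum.ub_add_nat[of 1 "k - q" ?f q] q r by (simp add: cum_def)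
    then have total: "(\<Sum>l = 1..Suc i. cum t l k) + real r * N =
        ?G + (\<Sum>j = Suc (k - q)..k. ?f j) + (\<Sum>j = 1..k - q. ?f j)"
      by simp
    have state: "?M q = add_mset 0 Z" using q by (simp add: Z_def)
    show ?case
      unfolding q_def[symmetric] state total tableau_word_Suc row append_assoc by (rule climb)
  qed
  have base: "?M (r - r) = replicate_mset r 0" by simp
  have ex: "\<exists>u. tableau_word n k t = u @ tableau_word r k t" 
  proof -
    have "r \<le> n" using r by simp
    then show ?thesis
    proof (induction rule: dec_induct)
      case (step m)
      then show ?case by (metis append_assoc tableau_word_Suc)
    qed simp
  qed
  then obtain u where u: "tableau_word n k t = u @ tableau_word r k t" by blast
  have "gain (u @ (tableau_word r k t @ staircase N k r)) (replicate_mset r 0) 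
     ((\<Sum>i = 1..r. cum t i k) + real r * N)"
    using main[OF order_refl] unfolding base by (rule gain_append_skip)
  then have "gain (filter (\<lambda>p. fst p \<le> k) (tableau_word n n t) @ staircase N k r) (replicate_mset r 0)
     ((\<Sum>i = 1..r. cum t i k) + real r * N)"
    using u by (simp add: filter_tableau_word r(2))
  then show ?thesis by (rule gain_filter)
qed

lemma greene_norm_word:
  assumes "nonneg w" shows "greene r (norm_word w) = Sup {g. gain w (replicate_mset r 0) g}"
proof -
  have "gain (norm_word w @ []) M g = gain (w @ []) M g" for M g
    using greene_equiv_norm[OF assms] unfolding greene_equiv_def by blast
  then show ?thesis by (simp add: greene_conv_Sup_gain[OF is_tword_norm])
qed

lemma greene_cong:
  assumes "w \<approx>\<^sub>G w'" "is_tword w" "is_tword w'" shows "greene r w = greene r w'"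
proof -
  have "gain (w @ []) M g = gain (w' @ []) M g" for M g
    using assms(1) unfolding greene_equiv_def by blast
  then show ?thesis using assms(2,3) by (simp add: greene_conv_Sup_gain)
qed

lemma greene_tableau_staircase:
  assumes t: "tableau t" and r: "1 \<le> r" "r \<le> k" "k \<le> n" and N: "tlen (tableau_word n n t) \<le> N"
  shows "greene r (norm_word (tableau_word n n t @ staircase N k r)) =
    (\<Sum>i = 1..r. cum t i k) + real r * N"
proof -
  have nn: "nonneg (tableau_word n n t)" by (rule nonneg_tableau_word[OF t])
  then have "0 \<le> N" using N tlen_nonneg[OF nn] by simp
  then have "nonneg (tableau_word n n t @ staircase N k r)"
    using nn by (auto simp: nonneg_def staircase_def)
  then show ?thesis
    by (simp add: greene_norm_word)
       (rule cSup_eq_maximum, use gain_tableau_staircase[OF t r(2,3)]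
          gain_tableau_staircase_le[OF t r N] in auto)
qed

lemma tableau_word_cum_unique:
  assumes t: "tableau t" and t': "tableau t'"
    and eq: "\<And>r k. 1 \<le> r \<Longrightarrow> r \<le> k \<Longrightarrow> k \<le> n \<Longrightarrow> (\<Sum>i = 1..r. cum t i k) = (\<Sum>i = 1..r. cum t' i k)"
  shows "tableau_word n n t = tableau_word n n t'"
proof -
  have c: "cum t i k = cum t' i k" if i: "1 \<le> i" and k: "k \<le> n" for i k
  proof (cases "i \<le> k")
    case True
    have s: "(\<Sum>l = 1..i. cum s l k) = (\<Sum>l = 1..i - 1. cum s l k) + cum s i k" for s
      using i by (cases i) auto
    have "(\<Sum>l = 1..i - 1. cum t l k) = (\<Sum>l = 1..i - 1. cum t' l k)"
      using eq[of "i - 1" k] True i k by (cases "i = 1") auto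
    then show ?thesis using eq[OF i True k] s[of t] s[of t'] by simp
  next
    case False
    have "cum s i k = 0" if "tableau s" for s
      using cum_below_diagonal[OF that i] cum_mono[OF that, of k "i - 1" i] cum_nonneg[OF that, of i k] False
      by simp
    then show ?thesis using t t' by simp
  qed
  have "t i j = t' i j" if "1 \<le> i" "1 \<le> j" "j \<le> n" for i j
    using c[of i j] c[of i "j - 1"] cum_Suc[of t i "j - 1"] cum_Suc[of t' i "j - 1"] that by simp
  then show ?thesis unfolding tableau_word_def row_word_def
    by (intro arg_cong[where f = concat] map_cong refl) auto
qed

theorem theorem3p9p1:
  fixes n :: nat and w w' :: tword
  assumes "n \<ge> 1" and "w \<in> twords n" and "w' \<in> twords n"
  shows "knuth_equiv n w w' \<longleftrightarrow>
    (\<forall>u \<in> twords n. \<forall>v \<in> twords n. \<forall>r>0. greene r (u \<cdot>\<^sub>t w \<cdot>\<^sub>t v) = greene r (u \<cdot>\<^sub>t w' \<cdot>\<^sub>t v))"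
proof
  assume "knuth_equiv n w w'"
  then have eq: "knuth_equiv n (u \<cdot>\<^sub>t w \<cdot>\<^sub>t v) (u \<cdot>\<^sub>t w' \<cdot>\<^sub>t v)" if "u \<in> twords n" "v \<in> twords n" for u v
    using that by (rule knuth_equiv_tconc)
  show "\<forall>u \<in> twords n. \<forall>v \<in> twords n. \<forall>r>0. greene r (u \<cdot>\<^sub>t w \<cdot>\<^sub>t v) = greene r (u \<cdot>\<^sub>t w' \<cdot>\<^sub>t v)"
  proof (intro ballI allI impI)
    fix u v :: tword and r :: nat assume uv: "u \<in> twords n" "v \<in> twords n"
    then have "u \<cdot>\<^sub>t w \<cdot>\<^sub>t v \<in> twords n" "u \<cdot>\<^sub>t w' \<cdot>\<^sub>t v \<in> twords n"
      using assms(2,3) by (simp_all add: tconc_in_twords)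
    then show "greene r (u \<cdot>\<^sub>t w \<cdot>\<^sub>t v) = greene r (u \<cdot>\<^sub>t w' \<cdot>\<^sub>t v)"
      using greene_cong[OF knuth_equiv_greene_equiv[OF eq[OF uv]]] by (simp add: twords_def)
  qed
next
  assume H: "\<forall>u \<in> twords n. \<forall>v \<in> twords n. \<forall>r>0. greene r (u \<cdot>\<^sub>t w \<cdot>\<^sub>t v) = greene r (u \<cdot>\<^sub>t w' \<cdot>\<^sub>t v)"
  have nw: "norm_word w = w" "norm_word w' = w'"
    using assms(2,3) by (simp_all add: norm_word_id twords_def)
  have in1: "letters_in 1 n w" "letters_in 1 n w'"
    using assms(2,3) twords_nonneg by (auto simp: letters_in_def twords_def)
  obtain t where t: "tableau t" "knuth_eq n w (tableau_word n n t)"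
    using ex_tableau[OF in1(1)] .
  obtain t' where t': "tableau t'" "knuth_eq n w' (tableau_word n n t')"
    using ex_tableau[OF in1(2)] .
  define N where "N = max (tlen (tableau_word n n t)) (tlen (tableau_word n n t'))"
  have N0: "0 \<le> N" using tlen_nonneg[OF nonneg_tableau_word[OF t(1), of n n]] by (simp add: N_def)
  have "(\<Sum>i = 1..r. cum t i k) = (\<Sum>i = 1..r. cum t' i k)" if rk: "1 \<le> r" "r \<le> k" "k \<le> n" for r k
  proof -
    define s where "s = staircase N k r"
    have s: "letters_in (Suc 0) n s" using rk N0 by (auto simp: s_def staircase_def letters_in_def nonneg_def)
    have g: "greene r ([] \<cdot>\<^sub>t x \<cdot>\<^sub>t norm_word s) = greene r (norm_word (tableau_word n n t @ s))"
      if x: "x \<in> twords n" "tableau t" "knuth_eq n x (tableau_word n n t)" for x t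
    proof -
      have "letters_in (Suc 0) n x"
        using x(1) twords_nonneg by (auto simp: letters_in_def twords_def)
      then have nn: "nonneg (x @ s)" "nonneg (tableau_word n n t @ s)"
        using s nonneg_tableau_word[OF x(2)] by (auto dest: letters_in_nonneg)
      have "knuth_eq n (x @ s) (tableau_word n n t @ s)"
        using knuth_eq_append[OF x(3), of "[]" s] s by simp
      then have "knuth_equiv n (norm_word (x @ s)) (norm_word (tableau_word n n t @ s))"
        by (simp add: knuth_eq_def)
      then have "greene r (norm_word (x @ s)) = greene r (norm_word (tableau_word n n t @ s))"
        by (intro greene_cong knuth_equiv_greene_equiv is_tword_norm)
      moreover have "[] \<cdot>\<^sub>t x \<cdot>\<^sub>t norm_word s = norm_word (x @ s)"
        using x(1) by (simp add: tconc_def norm_append norm_word_id twords_def)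
      ultimately show ?thesis by simp
    qed
    have "[] \<in> twords n" by (simp add: twords_def is_tword_def)
    then have "greene r ([] \<cdot>\<^sub>t w \<cdot>\<^sub>t norm_word s) = greene r ([] \<cdot>\<^sub>t w' \<cdot>\<^sub>t norm_word s)"
      using H letters_in_norm[OF s] rk(1) by simp
    then have "greene r (norm_word (tableau_word n n t @ s)) = greene r (norm_word (tableau_word n n t' @ s))"
      using g[OF assms(2) t] g[OF assms(3) t'] by simp
    then show ?thesis unfolding s_def
      using greene_tableau_staircase[OF t(1) rk, of N] greene_tableau_staircase[OF t'(1) rk, of N]
      by (simp add: N_def)
  qed
  then have "tableau_word n n t = tableau_word n n t'"
    by (rule tableau_word_cum_unique[OF t(1) t'(1)])
  then have "knuth_eq n w w'" using t(2) t'(2) by (metis knuth_eq_sym knuth_eq_trans)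
  then show "knuth_equiv n w w'" by (simp add: knuth_eq_def nw)
qed

end
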